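(* In the setting described in the context, there exist small constants $c,\ d'>0$ such that, given $D>0$, we have $$(\eta_\varepsilon)_t\leq -c\left(|t|+\varepsilon^{2/3}\right)^{-1/2}$$ in $\{-d'\leq t\leq D\varepsilon^{2/3},\ \theta\in[0,\ell_\varepsilon)\}$, provided $\varepsilon$ is sufficiently small.
   Context: Setting. $W:\mathbb{R}^2\to\mathbb{R}$ is nonnegative, $W\in C^1$, and there exist constants $C>1$, $p\geq 2$ with $\frac1C|\mathbf{y}|^p\leq W(\mathbf{y})\leq C|\mathbf{y}|^p$ for $|\mathbf{y}|\geq C$. Write $f^+=\max\{f,0\}$. The number $\lambda_0>\inf_{\mathbb{R}^2}W$ is uniquely determined by $\int_{\mathbb{R}^2}(\lambda_0-W)^+d\mathbf{y}=1$. It is assumed that $\mathcal{D}_0=\{\mathbf{y}\in\mathbb{R}^2: W(\mathbf{y})<\lambda_0\}$ is a simply connected bounded domain containing the origin, with smooth boundary, and that $\partial W/\partial\mathbf{n}>0$ on $\partial\mathcal{D}_0$, $\mathbf{n}$ being the outward unit normal to $\partial\mathcal{D}_0$. For small $\varepsilon>0$ let $G_\varepsilon(u)=\int_{\mathbb{R}^2}\{\frac12|\nabla u|^2+\frac{1}{4\varepsilon^2}|u|^4+\frac{1}{2\varepsilon^2}W(\mathbf{y})|u|^2\}d\mathbf{y}$, minimized in $\mathcal{H}=\{u\in W^{1,2}(\mathbb{R}^2;\mathbb{C}):\int_{\mathbb{R}^2} W|u|^2d\mathbf{y}<\infty,\ \int_{\mathbb{R}^2}|u|^2d\mathbf{y}=1\}$.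 It is known that $G_\varepsilon$ has a unique real valued minimizer $\eta_\varepsilon>0$ in $\mathcal{H}$; it satisfies $-\Delta\eta_\varepsilon+\frac{1}{\varepsilon^2}\eta_\varepsilon(W(\mathbf{y})+\eta_\varepsilon^2)=\frac{1}{\varepsilon^2}\lambda_\varepsilon\eta_\varepsilon$ in $\mathbb{R}^2$, $\eta_\varepsilon\to0$ as $|\mathbf{y}|\to\infty$, where $\varepsilon^{-2}\lambda_\varepsilon$ is the (unique) Lagrange multiplier. It is known that $|\lambda_\varepsilon-\lambda_0|\leq C|\ln\varepsilon|^{1/2}\varepsilon$ for small $\varepsilon$. Tubular coordinates. Let $a_\varepsilon=\lambda_\varepsilon-W$. For $\varepsilon\ge0$ small, $\mathcal{D}_0$ perturbs smoothly to a simply connected domain $\mathcal{D}_\varepsilon$ with $a_\varepsilon>0$ in $\mathcal{D}_\varepsilon$, $a_\varepsilon<0$ in $\mathbb{R}^2\setminus\overline{\mathcal{D}_\varepsilon}$, and outward normal derivative of $a_\varepsilon$ on $\partial\mathcal{D}_\varepsilon$ bounded above by a negative constant independent of $\varepsilon$. $\Gamma_\varepsilon=\partial\mathcal{D}_\varepsilon$ is a simple, smooth closed curve of length $\ell_\varepsilon$, with positively oriented arc length parametrization $\gamma_\varepsilon(\theta)$, $\theta\in[0,\ell_\varepsilon)$, and outward unit normal $\nu_\varepsilon(\theta)$. Points close to $\Gamma_\varepsilon$ are written $\mathbf{y}=\gamma_\varepsilon(\theta)+t\nu_\varepsilon(\theta)$, $|t|<\delta_0$ ($\delta_0>0$ small,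 independent of $\varepsilon$); thus $t<0$ in $\mathcal{D}_\varepsilon$. The subscript $t$ denotes the partial derivative in the coordinates $(t,\theta)$. Constants denoted $c$, $C$ are independent of $\varepsilon$.
   Formalization: The constant c is allowed to depend on D (d' is not): with c independent of D the claim is false, since integrating the bound over 0 ≤ t ≤ Dε^{2/3} would force η_ε on Γ_ε to exceed 2cε^{1/3}(√(D+1)−1), while η_ε ≤ Cε^{1/3} there. *)

theory Defs
  imports "HOL-Analysis.Analysis"
begin

text \<open>\<open>C_k k f\<close>: \<open>f\<close> is of class \<open>C\<^sup>k\<close> on the whole space (in finite dimension, \<open>C\<^sup>k\<^sup>+\<^sup>1\<close> means
  differentiable with all directional derivatives of class \<open>C\<^sup>k\<close>).\<close>

primrec C_k :: "nat \<Rightarrow> ('a::real_normed_vector \<Rightarrow> 'b::real_normed_vector) \<Rightarrow> bool" where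
  "C_k 0 f \<longleftrightarrow> continuous_on UNIV f"
| "C_k (Suc k) f \<longleftrightarrow> (\<forall>x. f differentiable (at x)) \<and>
      (\<forall>v. C_k k (\<lambda>x. frechet_derivative f (at x) v))"

definition smooth :: "('a::real_normed_vector \<Rightarrow> 'b::real_normed_vector) \<Rightarrow> bool" where
  "smooth f \<longleftrightarrow> (\<forall>k. C_k k f)"

definition partial_deriv :: "2 \<Rightarrow> (real^2 \<Rightarrow> real) \<Rightarrow> real^2 \<Rightarrow> real" where
  "partial_deriv i f y = frechet_derivative f (at y) (axis i 1)"

definition laplacian :: "(real^2 \<Rightarrow> real) \<Rightarrow> real^2 \<Rightarrow> real" where
  "laplacian f y = (\<Sum>i\<in>UNIV. partial_deriv i (partial_deriv i f) y)"


section \<open>The energy and its minimizers\<close>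

definition test_function :: "(real^2 \<Rightarrow> real) \<Rightarrow> bool" where
  "test_function \<phi> \<longleftrightarrow> smooth \<phi> \<and> compact (closure {y. \<phi> y \<noteq> 0})"

definition L2_function :: "(real^2 \<Rightarrow> complex) \<Rightarrow> bool" where
  "L2_function u \<longleftrightarrow> u \<in> borel_measurable lebesgue \<and> integrable lebesgue (\<lambda>y. (cmod (u y))\<^sup>2)"

definition is_weak_deriv :: "2 \<Rightarrow> (real^2 \<Rightarrow> complex) \<Rightarrow> (real^2 \<Rightarrow> complex) \<Rightarrow> bool" where
  "is_weak_deriv i u g \<longleftrightarrow> (\<forall>\<phi>. test_function \<phi> \<longrightarrow>
     (LINT y|lebesgue. partial_deriv i \<phi> y *\<^sub>R u y) = - (LINT y|lebesgue. \<phi> y *\<^sub>R g y))"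

definition W12 :: "(real^2 \<Rightarrow> complex) set" where
  "W12 = {u. L2_function u \<and> (\<forall>i. \<exists>g. L2_function g \<and> is_weak_deriv i u g)}"

text \<open>Functions are not identified when they agree almost everywhere; the weak derivative is
  determined up to a null set, so the choice below does not affect integrals.\<close>

definition weak_deriv :: "2 \<Rightarrow> (real^2 \<Rightarrow> complex) \<Rightarrow> real^2 \<Rightarrow> complex" where
  "weak_deriv i u = (SOME g. L2_function g \<and> is_weak_deriv i u g)"

definition GP_space :: "(real^2 \<Rightarrow> real) \<Rightarrow> (real^2 \<Rightarrow> complex) set" where
  "GP_space W = {u \<in> W12. integrable lebesgue (\<lambda>y. W y * (cmod (u y))\<^sup>2) \<and>
                          (LINT y|lebesgue. (cmod (u y))\<^sup>2) = 1}"

definition GP_energy :: "(real^2 \<Rightarrow> real) \<Rightarrow> real \<Rightarrow> (real^2 \<Rightarrow> complex) \<Rightarrow> ennreal" where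
  "GP_energy W \<epsilon> u = (\<integral>\<^sup>+ y. ennreal (1/2 * (\<Sum>i\<in>UNIV. (cmod (weak_deriv i u y))\<^sup>2)
      + 1 / (4 * \<epsilon>\<^sup>2) * (cmod (u y)) ^ 4 + 1 / (2 * \<epsilon>\<^sup>2) * W y * (cmod (u y))\<^sup>2) \<partial>lebesgue)"

definition GP_minimizer :: "(real^2 \<Rightarrow> real) \<Rightarrow> real \<Rightarrow> (real^2 \<Rightarrow> complex) \<Rightarrow> bool" where
  "GP_minimizer W \<epsilon> u \<longleftrightarrow> u \<in> GP_space W \<and> (\<forall>v\<in>GP_space W. GP_energy W \<epsilon> u \<le> GP_energy W \<epsilon> v)"

definition positive_GP_minimizer :: "(real^2 \<Rightarrow> real) \<Rightarrow> real \<Rightarrow> (real^2 \<Rightarrow> real) \<Rightarrow> bool" where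
  "positive_GP_minimizer W \<epsilon> w \<longleftrightarrow> (\<forall>y. w y > 0) \<and> GP_minimizer W \<epsilon> (\<lambda>y. complex_of_real (w y))"


section \<open>Planar domains, their boundaries and tubular coordinates\<close>

definition simply_connected_domain :: "(real^2) set \<Rightarrow> bool" where
  "simply_connected_domain S \<longleftrightarrow> open S \<and> S \<noteq> {} \<and> connected S \<and> simply_connected S"

definition smooth_boundary :: "(real^2) set \<Rightarrow> bool" where
  "smooth_boundary S \<longleftrightarrow> (\<forall>x\<in>frontier S. \<exists>U (f :: real^2 \<Rightarrow> real).
     open U \<and> x \<in> U \<and> smooth f \<and> (\<forall>y\<in>U. frechet_derivative f (at y) \<noteq> (\<lambda>v. 0)) \<and>
     S \<inter> U = {y\<in>U. f y < 0} \<and> frontier S \<inter> U = {y\<in>U. f y = 0})"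

text \<open>At a boundary point of a \<open>C\<^sup>1\<close> domain exactly one vector satisfies this.\<close>

definition outward_unit_normal :: "(real^2) set \<Rightarrow> real^2 \<Rightarrow> real^2 \<Rightarrow> bool" where
  "outward_unit_normal S x n \<longleftrightarrow> x \<in> frontier S \<and> norm n = 1 \<and>
     (\<forall>v. v \<bullet> n < 0 \<longrightarrow> (\<forall>\<^sub>F s in at_right 0. x + s *\<^sub>R v \<in> S)) \<and>
     (\<forall>v. v \<bullet> n > 0 \<longrightarrow> (\<forall>\<^sub>F s in at_right 0. x + s *\<^sub>R v \<notin> closure S))"

text \<open>\<open>\<gamma>\<close> is a smooth arc length parametrization, extended \<open>L\<close>-periodically to the line, of the
  simple closed curve bounding \<open>S\<close>, and \<open>\<nu>\<close> is the outward unit normal along it.  Positive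
  orientation means that \<open>\<nu>\<close> is the tangent turned clockwise by a right angle.\<close>

definition arc_length_boundary ::
  "(real^2) set \<Rightarrow> real \<Rightarrow> (real \<Rightarrow> real^2) \<Rightarrow> (real \<Rightarrow> real^2) \<Rightarrow> bool" where
  "arc_length_boundary S L \<gamma> \<nu> \<longleftrightarrow> L > 0 \<and> smooth \<gamma> \<and> (\<forall>\<theta>. \<gamma> (\<theta> + L) = \<gamma> \<theta>) \<and>
     bij_betw \<gamma> {0..<L} (frontier S) \<and>
     (\<forall>\<theta>. norm (vector_derivative \<gamma> (at \<theta>)) = 1) \<and>
     (\<forall>\<theta>. outward_unit_normal S (\<gamma> \<theta>) (\<nu> \<theta>)) \<and>
     (\<forall>\<theta>. \<nu> \<theta> = vector [vector_derivative \<gamma> (at \<theta>) $ 2, - (vector_derivative \<gamma> (at \<theta>) $ 1)])"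

definition tube :: "(real \<Rightarrow> real^2) \<Rightarrow> (real \<Rightarrow> real^2) \<Rightarrow> real \<Rightarrow> real \<Rightarrow> real^2" where
  "tube \<gamma> \<nu> t \<theta> = \<gamma> \<theta> + t *\<^sub>R \<nu> \<theta>"

definition deriv_t ::
  "(real \<Rightarrow> real^2) \<Rightarrow> (real \<Rightarrow> real^2) \<Rightarrow> (real^2 \<Rightarrow> real) \<Rightarrow> real \<Rightarrow> real \<Rightarrow> real" where
  "deriv_t \<gamma> \<nu> u t \<theta> = deriv (\<lambda>s. u (tube \<gamma> \<nu> s \<theta>)) t"

text \<open>The curves \<open>\<Gamma> \<epsilon>\<close> converge smoothly, as \<open>\<epsilon> \<rightarrow> 0\<^sup>+\<close>, to the curve \<open>\<gamma>\<close> of length \<open>L\<close> with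
  normal \<open>\<nu>\<close>: they are normal graphs over it, of smooth functions tending to zero uniformly
  together with all their derivatives.\<close>

definition smooth_perturbation ::
  "real \<Rightarrow> (real \<Rightarrow> (real^2) set) \<Rightarrow> real \<Rightarrow> (real \<Rightarrow> real^2) \<Rightarrow> (real \<Rightarrow> real^2) \<Rightarrow> bool" where
  "smooth_perturbation \<epsilon>\<^sub>0 \<Gamma> L \<gamma> \<nu> \<longleftrightarrow> (\<exists>\<rho> :: real \<Rightarrow> real \<Rightarrow> real.
     (\<forall>\<epsilon>\<in>{0<..<\<epsilon>\<^sub>0}. smooth (\<rho> \<epsilon>) \<and> (\<forall>\<theta>. \<rho> \<epsilon> (\<theta> + L) = \<rho> \<epsilon> \<theta>) \<and>
        \<Gamma> \<epsilon> = (\<lambda>\<theta>. tube \<gamma> \<nu> (\<rho> \<epsilon> \<theta>) \<theta>) ` {0..<L}) \<and>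
     (\<forall>k. uniform_limit UNIV (\<lambda>\<epsilon>. (deriv ^^ k) (\<rho> \<epsilon>)) (\<lambda>\<theta>. 0) (at_right 0)))"

end

theory Submission
  imports Defs "HOL-Real_Asymp.Real_Asymp"
begin

text \<open>With \<open>v(s) = \<epsilon>\<^sup>-\<^sup>1\<^sup>/\<^sup>3 \<eta>\<^sub>\<epsilon>(\<gamma> + \<epsilon>\<^sup>2\<^sup>/\<^sup>3 s)\<close> and \<open>a(s) = \<epsilon>\<^sup>-\<^sup>2\<^sup>/\<^sup>3 (\<lambda>\<^sub>\<epsilon> - W)(\<gamma> + \<epsilon>\<^sup>2\<^sup>/\<^sup>3 s)\<close> the equation becomes
  \<open>\<Delta>v = v (v\<^sup>2 - a)\<close> on a ball of radius of order \<open>\<epsilon>\<^sup>-\<^sup>2\<^sup>/\<^sup>3\<close>, where \<open>a\<close> is Lipschitz and decreases at a definite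
  rate in the normal direction \<open>e\<close>; all constants are uniform in \<open>\<epsilon>\<close> and in the base point \<open>\<gamma>\<close>.  The
  claim becomes \<open>\<partial>\<^sub>e v \<le> - c (1 + |t|)\<^sup>-\<^sup>1\<^sup>/\<^sup>2\<close> at \<open>t e\<close>, and every step is a comparison at an interior maximum.
  As \<open>W\<close> is only \<open>C\<^sup>1\<close>, \<open>\<partial>\<^sub>e v\<close> need not be \<open>C\<^sup>2\<close>; the comparisons are made for the difference quotients of
  \<open>v\<close> in the direction \<open>e\<close>, which satisfy a linear equation with a negative source.

  Where \<open>a \<ge> M\<close> with \<open>M\<close> large, \<open>v\<^sup>2\<close> is close to \<open>a\<close>, so the linearized operator is coercive and a quadratic
  barrier gives \<open>\<partial>\<^sub>e v \<le> - c a\<^sup>-\<^sup>1\<^sup>/\<^sup>2\<close>.  In the remaining strip coercivity is replaced by the positive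
  supersolution \<open>v\<close>: on a long curved box \<open>- K \<le> a \<le> T\<close> one compares with
  \<open>- b v + \<delta> + (A / N\<^sup>2) v (x \<bullet> f)\<^sup>2\<close>, \<open>f\<close> being tangential.  On the side \<open>a = T\<close> the first bound applies, on
  \<open>a = - K\<close> both \<open>v\<close> and its gradient are small, and the lateral sides are far away.\<close>

section \<open>Second order jets and the maximum principle\<close>

text \<open>\<open>has_jet f x P l\<close>: \<open>f\<close> is twice differentiable at \<open>x\<close>, with gradient \<open>P\<close> and Laplacian \<open>l\<close> there.\<close>

definition has_jet :: "(real^2 \<Rightarrow> real) \<Rightarrow> real^2 \<Rightarrow> real^2 \<Rightarrow> real \<Rightarrow> bool" where
  "has_jet f x P l \<longleftrightarrow> (\<exists>G H. (\<forall>\<^sub>F y in nhds x. (f has_derivative (\<lambda>v. G y \<bullet> v)) (at y)) \<and>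
     (G has_derivative H) (at x) \<and> G x = P \<and> l = (\<Sum>i\<in>UNIV. H (axis i 1) $ i))"

lemma has_jetI:
  assumes "\<And>y. (f has_derivative (\<lambda>v. G y \<bullet> v)) (at y)" "(G has_derivative H) (at x)"
    "P = G x" "l = (\<Sum>i\<in>UNIV. H (axis i 1) $ i)"
  shows "has_jet f x P l"
  unfolding has_jet_def using assms by (intro exI[of _ G] exI[of _ H]) auto

lemma has_jet_derivative:
  assumes "has_jet f x P l" shows "(f has_derivative (\<lambda>v. P \<bullet> v)) (at x)"
  using assms unfolding has_jet_def by (auto dest: eventually_nhds_x_imp_x)

lemma has_jet_isCont:
  assumes "has_jet f x P l" shows "isCont f x"
  using has_derivative_continuous[OF has_jet_derivative[OF assms]] by simp

section \<open>Calculus of second order jets\<close>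

lemma has_jet_const: "has_jet (\<lambda>_. k) x 0 0"
  by (rule has_jetI[where G="\<lambda>_. 0" and H="\<lambda>_. 0"]) auto

lemma has_jet_inner: "has_jet (\<lambda>y. y \<bullet> b) x b 0"
  by (rule has_jetI[where G="\<lambda>_. b" and H="\<lambda>_. 0"])
     (auto intro!: derivative_eq_intros simp: inner_commute)

lemma has_jet_add:
  assumes "has_jet f x P l" "has_jet g x Q k"
  shows "has_jet (\<lambda>y. f y + g y) x (P + Q) (l + k)"
proof -
  obtain G H where 1: "\<forall>\<^sub>F y in nhds x. (f has_derivative (\<lambda>v. G y \<bullet> v)) (at y)"
     "(G has_derivative H) (at x)" "G x = P" "l = (\<Sum>i\<in>UNIV. H (axis i 1) $ i)"
    using assms(1) unfolding has_jet_def by blast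
  obtain G' H' where 2: "\<forall>\<^sub>F y in nhds x. (g has_derivative (\<lambda>v. G' y \<bullet> v)) (at y)"
     "(G' has_derivative H') (at x)" "G' x = Q" "k = (\<Sum>i\<in>UNIV. H' (axis i 1) $ i)"
    using assms(2) unfolding has_jet_def by blast
  show ?thesis unfolding has_jet_def
  proof (intro exI conjI)
    show "\<forall>\<^sub>F y in nhds x. ((\<lambda>y. f y + g y) has_derivative (\<lambda>v. (G y + G' y) \<bullet> v)) (at y)"
      using 1(1) 2(1)
      by eventually_elim (auto intro!: derivative_eq_intros simp: inner_add_left)
    show "((\<lambda>y. G y + G' y) has_derivative (\<lambda>v. H v + H' v)) (at x)"
      using 1(2) 2(2) by (rule has_derivative_add)
  qed (use 1 2 in \<open>auto simp: sum.distrib\<close>)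
qed

lemma has_jet_mult:
  assumes "has_jet f x P l" "has_jet g x Q k"
  shows "has_jet (\<lambda>y. f y * g y) x (f x *\<^sub>R Q + g x *\<^sub>R P) (f x * k + 2 * (P \<bullet> Q) + g x * l)"
proof -
  obtain G H where 1: "\<forall>\<^sub>F y in nhds x. (f has_derivative (\<lambda>v. G y \<bullet> v)) (at y)"
     "(G has_derivative H) (at x)" "G x = P" "l = (\<Sum>i\<in>UNIV. H (axis i 1) $ i)"
    using assms(1) unfolding has_jet_def by blast
  obtain G' H' where 2: "\<forall>\<^sub>F y in nhds x. (g has_derivative (\<lambda>v. G' y \<bullet> v)) (at y)"
     "(G' has_derivative H') (at x)" "G' x = Q" "k = (\<Sum>i\<in>UNIV. H' (axis i 1) $ i)"
    using assms(2) unfolding has_jet_def by blast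
  have f: "(f has_derivative (\<lambda>v. P \<bullet> v)) (at x)" and g: "(g has_derivative (\<lambda>v. Q \<bullet> v)) (at x)"
    using assms by (auto intro: has_jet_derivative)
  show ?thesis unfolding has_jet_def
  proof (intro exI conjI)
    show "\<forall>\<^sub>F y in nhds x. ((\<lambda>y. f y * g y) has_derivative (\<lambda>v. (f y *\<^sub>R G' y + g y *\<^sub>R G y) \<bullet> v)) (at y)"
      using 1(1) 2(1)
      by eventually_elim (auto intro!: derivative_eq_intros simp: inner_add_left algebra_simps)
    show "((\<lambda>y. f y *\<^sub>R G' y + g y *\<^sub>R G y) has_derivative
        (\<lambda>v. (f x *\<^sub>R H' v + (P \<bullet> v) *\<^sub>R G' x) + (g x *\<^sub>R H v + (Q \<bullet> v) *\<^sub>R G x))) (at x)"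
      by (intro has_derivative_add has_derivative_scaleR f g 1 2)
  qed (use 1 2 in \<open>auto simp: sum_2 inner_vec_def axis_def algebra_simps\<close>)
qed

lemma has_jet_cmult:
  assumes "has_jet f x P l"
  shows "has_jet (\<lambda>y. k * f y) x (k *\<^sub>R P) (k * l)"
  using has_jet_mult[OF has_jet_const[of k] assms] by simp

lemma has_jet_diff:
  assumes "has_jet f x P l" "has_jet g x Q k"
  shows "has_jet (\<lambda>y. f y - g y) x (P - Q) (l - k)"
  using has_jet_add[OF assms(1) has_jet_cmult[OF assms(2), of "-1"]] by simp

lemma has_jet_exp:
  assumes "has_jet f x P l"
  shows "has_jet (\<lambda>y. exp (f y)) x (exp (f x) *\<^sub>R P) (exp (f x) * (l + P \<bullet> P))"
proof -
  obtain G H where 1: "\<forall>\<^sub>F y in nhds x. (f has_derivative (\<lambda>v. G y \<bullet> v)) (at y)"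
     "(G has_derivative H) (at x)" "G x = P" "l = (\<Sum>i\<in>UNIV. H (axis i 1) $ i)"
    using assms(1) unfolding has_jet_def by blast
  have f: "(f has_derivative (\<lambda>v. P \<bullet> v)) (at x)"
    using assms by (auto intro: has_jet_derivative)
  have e: "((\<lambda>y. exp (f y)) has_derivative (\<lambda>v. exp (f x) * (P \<bullet> v))) (at x)"
    by (auto intro!: derivative_eq_intros f)
  show ?thesis unfolding has_jet_def
  proof (intro exI conjI)
    show "\<forall>\<^sub>F y in nhds x. ((\<lambda>y. exp (f y)) has_derivative (\<lambda>v. (exp (f y) *\<^sub>R G y) \<bullet> v)) (at y)"
      using 1(1)
      by eventually_elim (auto intro!: derivative_eq_intros)
    show "((\<lambda>y. exp (f y) *\<^sub>R G y) has_derivative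
        (\<lambda>v. exp (f x) *\<^sub>R H v + (exp (f x) * (P \<bullet> v)) *\<^sub>R G x)) (at x)"
      by (intro has_derivative_scaleR e 1)
  qed (use 1 in \<open>auto simp: sum_2 inner_vec_def axis_def algebra_simps\<close>)
qed

lemma has_jet_dist_sq: "has_jet (\<lambda>y. (y - p) \<bullet> (y - p)) x (2 *\<^sub>R (x - p)) 4"
  by (rule has_jetI[where G="\<lambda>y. 2 *\<^sub>R (y - p)" and H="\<lambda>v. 2 *\<^sub>R v"])
     (auto intro!: derivative_eq_intros simp: fun_eq_iff inner_commute inner_diff_left inner_diff_right axis_def)

text \<open>Serves two cases: dilations, where \<open>k\<close> is the square of the factor, and the
  reflection in a coordinate, where \<open>k = 1\<close>. Symmetry of \<open>A\<close> makes
  \<open>A P\<close> the new gradient. As \<open>A\<close> is diagonal in the standard basis, each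
  diagonal entry of the Hessian is multiplied by \<open>s * s = k\<close>.\<close>

lemma has_jet_compose_linear:
  fixes A :: "real^2 \<Rightarrow> real^2"
  assumes f: "has_jet f (p + A x) P l" and A: "linear A"
    and sym: "\<And>u v. A u \<bullet> v = u \<bullet> A v" and sq: "\<And>v. A (A v) = k *\<^sub>R v"
    and diag: "\<And>i. \<exists>s. A (axis i 1) = s *\<^sub>R axis i 1"
  shows "has_jet (\<lambda>y. f (p + A y)) x (A P) (k * l)"
proof -
  obtain G H where 1: "\<forall>\<^sub>F y in nhds (p + A x). (f has_derivative (\<lambda>v. G y \<bullet> v)) (at y)"
     "(G has_derivative H) (at (p + A x))" "G (p + A x) = P" "l = (\<Sum>i\<in>UNIV. H (axis i 1) $ i)"
    using f unfolding has_jet_def by blast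
  have bl: "bounded_linear A" using A by (simp add: linear_conv_bounded_linear)
  have dA: "((\<lambda>y. p + A y) has_derivative A) (at y)" for y
    using bounded_linear.has_derivative[OF bl has_derivative_ident]
    by (auto intro!: derivative_eq_intros)
  have lim: "filterlim (\<lambda>y. p + A y) (nhds (p + A x)) (nhds x)"
    using has_derivative_continuous[OF dA] tendsto_nhds_iff[of "\<lambda>y. p + A y" "p + A x" x] by (simp add: continuous_at)
  show ?thesis unfolding has_jet_def
  proof (intro exI conjI)
    have "\<forall>\<^sub>F y in nhds x. (f has_derivative (\<lambda>v. G (p + A y) \<bullet> v)) (at (p + A y))"
      using filterlim_iff[THEN iffD1, OF lim, rule_format, OF 1(1)] .
    then show "\<forall>\<^sub>F y in nhds x. ((\<lambda>y. f (p + A y)) has_derivative (\<lambda>v. A (G (p + A y)) \<bullet> v)) (at y)"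
      by eventually_elim (use has_derivative_compose[OF dA] sym in auto)
    have "((\<lambda>y. G (p + A y)) has_derivative (\<lambda>v. H (A v))) (at x)"
      using has_derivative_compose[OF dA 1(2)] .
    then show "((\<lambda>y. A (G (p + A y))) has_derivative (\<lambda>v. A (H (A v)))) (at x)"
      using bounded_linear.has_derivative[OF bl] by blast
    have H: "linear H" using 1(2) by (simp add: has_derivative_linear)
    have "A (H (A (axis i 1))) $ i = k * H (axis i 1) $ i" for i
    proof -
      obtain s where s: "A (axis i 1) = s *\<^sub>R axis i 1" using diag by blast
      have "(s * s) *\<^sub>R axis i 1 = k *\<^sub>R (axis i 1 :: real^2)"
        using sq[of "axis i 1"] s by (simp add: linear_scale[OF A])
      then have "s * s = k" by simp
      moreover have "A (H (A (axis i 1))) $ i = A (H (A (axis i 1))) \<bullet> axis i 1"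
        by (simp add: inner_axis)
      moreover have "\<dots> = s * (s * H (axis i 1) $ i)"
        by (simp only: sym s) (simp add: linear_scale[OF H] inner_axis)
      ultimately show ?thesis by (simp add: mult.assoc)
    qed
    then show "k * l = (\<Sum>i\<in>UNIV. A (H (A (axis i 1))) $ i)"
      by (simp add: 1 sum_distrib_left)
  qed (use 1 in auto)
qed

lemma has_jet_scale:
  assumes "has_jet f (p + k *\<^sub>R x) P l"
  shows "has_jet (\<lambda>y. f (p + k *\<^sub>R y)) x (k *\<^sub>R P) (k\<^sup>2 * l)"
  by (rule has_jet_compose_linear[where A="\<lambda>y. k *\<^sub>R y"])
     (use assms in \<open>auto intro: linear_scaleR simp: power2_eq_square\<close>)

lemma has_jet_shift:
  assumes "has_jet f (x + p) P l"
  shows "has_jet (\<lambda>y. f (y + p)) x P l"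
  using has_jet_scale[of f p 1 x P l] assms by (simp add: add.commute)

section \<open>Necessary conditions at an interior maximum\<close>

text \<open>If \<open>D\<close> were positive, \<open>g'\<close> would be positive just to the right
  of 0, and by the mean value theorem \<open>g\<close> would exceed \<open>g 0\<close>
  there.\<close>

lemma second_derivative_nonpos_at_max:
  fixes g :: "real \<Rightarrow> real"
  assumes g: "\<forall>\<^sub>F s in nhds 0. (g has_real_derivative g' s) (at s)"
    and g': "(g' has_real_derivative D) (at 0)"
    and max: "\<forall>\<^sub>F s in nhds 0. g s \<le> g 0"
  shows "g' 0 = 0 \<and> D \<le> 0"
proof
  obtain d where d: "d > 0" and dg: "\<And>s. dist s 0 < d \<Longrightarrow> (g has_real_derivative g' s) (at s) \<and> g s \<le> g 0"
    using eventually_conj[OF g max] unfolding eventually_nhds_metric by blast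
  show z: "g' 0 = 0"
    by (rule DERIV_local_max[of g _ 0 d]) (use d dg in \<open>auto simp: dist_real_def\<close>)
  show "D \<le> 0"
  proof (rule ccontr)
    assume "\<not> D \<le> 0"
    then obtain d' where d': "d' > 0" "\<And>h. h > 0 \<Longrightarrow> h < d' \<Longrightarrow> g' 0 < g' (0 + h)"
      using DERIV_pos_inc_right[OF g'] by auto
    define s where "s = min d d' / 2"
    have s: "0 < s" "s < d" "s < d'" using d d' by (auto simp: s_def)
    have "\<exists>z>0. z < s \<and> g s - g 0 = (s - 0) * g' z"
      by (rule MVT2) (use s dg in \<open>auto simp: dist_real_def\<close>)
    then obtain y where y: "0 < y" "y < s" "g s - g 0 = s * g' y" by auto
    have "g' y > 0" using d'(2)[of y] y s z by auto
    then have "g s > g 0" using y s by (smt (verit) mult_pos_pos)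
    then show False using dg[of s] s by (auto simp: dist_real_def)
  qed
qed

text \<open>The one variable test is applied along each coordinate axis; the second derivatives
  obtained add up to the Laplacian. All comparison arguments below end in this fact.\<close>

lemma has_jet_local_max:
  assumes f: "has_jet f x P l" and max: "\<forall>\<^sub>F y in nhds x. f y \<le> f x"
  shows "P = 0" and "l \<le> 0"
proof -
  obtain G H where 1: "\<forall>\<^sub>F y in nhds x. (f has_derivative (\<lambda>v. G y \<bullet> v)) (at y)"
     "(G has_derivative H) (at x)" "G x = P" "l = (\<Sum>i\<in>UNIV. H (axis i 1) $ i)"
    using f unfolding has_jet_def by blast
  have *: "P $ i = 0 \<and> H (axis i 1) $ i \<le> 0" for i
  proof -
    let ?k = "\<lambda>s. x + s *\<^sub>R axis i 1 :: real^2"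
    have k: "(?k has_derivative (\<lambda>t. t *\<^sub>R axis i 1)) (at s)" for s
      by (auto intro!: derivative_eq_intros)
    have "continuous (at 0) ?k" by (intro continuous_intros)
    then have lim: "filterlim ?k (nhds x) (nhds 0)"
      unfolding continuous_at by (simp add: tendsto_nhds_iff)
    have e1: "\<forall>\<^sub>F s in nhds 0. ((\<lambda>s. f (?k s)) has_real_derivative (G (?k s) $ i)) (at s)"
      using filterlim_iff[THEN iffD1, OF lim, rule_format, OF 1(1)]
    proof eventually_elim
      case (elim s)
      from has_derivative_compose[OF k elim] show ?case
        by (simp add: has_field_derivative_def inner_axis mult_commute_abs)
    qed
    have "((\<lambda>s. G (?k s)) has_derivative (\<lambda>t. H (t *\<^sub>R axis i 1))) (at 0)"
      using has_derivative_compose[OF k[of 0], of G H] 1(2) by simp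
    then have "((\<lambda>s. G (?k s) $ i) has_derivative (\<lambda>t. H (t *\<^sub>R axis i 1) $ i)) (at 0)"
      by (rule bounded_linear.has_derivative[OF bounded_linear_vec_nth])
    then have e2: "((\<lambda>s. G (?k s) $ i) has_real_derivative (H (axis i 1) $ i)) (at 0)"
      using has_derivative_linear[OF 1(2)]
      by (simp add: has_field_derivative_def linear_scale mult_commute_abs)
    have e3: "\<forall>\<^sub>F s in nhds 0. f (?k s) \<le> f (?k 0)"
      using filterlim_iff[THEN iffD1, OF lim, rule_format, OF max] by simp
    from second_derivative_nonpos_at_max[OF e1 e2 e3] 1(3) show ?thesis by simp
  qed
  show "P = 0" using * by (simp add: vec_eq_iff)
  show "l \<le> 0" unfolding 1(4) using * by (simp add: sum_nonpos)
qed

section \<open>Pointwise bounds\<close>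

text \<open>The equation is posed on the whole plane, while \<open>a\<close> is left arbitrary: each
  estimate asks for bounds on \<open>a\<close> only in the ball where it works.\<close>

locale ground_state =
  fixes v a :: "real^2 \<Rightarrow> real" and g :: "real^2 \<Rightarrow> real^2"
  assumes pos: "v x > 0"
    and jet: "has_jet v x (g x) (v x * ((v x)\<^sup>2 - a x))"
begin

lemma cont: "continuous_on S v"
  using has_jet_isCont[OF jet] by (simp add: continuous_at_imp_continuous_on)

text \<open>Touch \<open>v\<close> from below by a multiple of \<open>q\<^sup>2\<close>, \<open>q x = 1 - |x - y|\<^sup>2 / R\<^sup>2\<close>; the upper bound is dual, touching
  from above by a multiple of \<open>1 / q\<close>.  Since \<open>1 / q\<close> blows up on the circle of radius \<open>R\<close>, no a priori bound on
  \<open>v\<close> is needed.\<close>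

lemma lower_bound:
  assumes R: "R > 0" and m: "\<And>x. dist y x < R \<Longrightarrow> m \<le> a x"
  shows "m - 8 / R\<^sup>2 \<le> (v y)\<^sup>2"
proof -
  define q where "q = (\<lambda>x. 1 - (1 / R\<^sup>2) * ((x - y) \<bullet> (x - y)))"
  have jq: "has_jet q x (0 - (1 / R\<^sup>2) *\<^sub>R (2 *\<^sub>R (x - y))) (0 - (1 / R\<^sup>2) * 4)" for x
    unfolding q_def by (intro has_jet_diff has_jet_cmult has_jet_const has_jet_dist_sq)
  have qle: "q x \<le> 1" for x using R by (simp add: q_def)
  have q0: "q x > 0 \<longleftrightarrow> dist y x < R" for x
  proof -
    have "q x > 0 \<longleftrightarrow> (dist y x)\<^sup>2 < R\<^sup>2"
      using R by (simp add: q_def field_simps dist_norm norm_minus_commute power2_norm_eq_inner)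
    then show ?thesis using R by (metis less_imp_le power2_less_imp_less power_strict_mono zero_le_dist zero_less_numeral)
  qed
  have q0': "q x \<ge> 0" if "x \<in> cball y R" for x
  proof -
    have "(dist y x)\<^sup>2 \<le> R\<^sup>2" using that R by (intro power_mono) auto
    then show ?thesis using R by (simp add: q_def field_simps dist_norm norm_minus_commute power2_norm_eq_inner)
  qed
  \<comment> \<open>The best constant in \<open>\<mu> * (q x)\<^sup>2 \<le> v x\<close> is the
    minimum of \<open>v / q\<^sup>2\<close>. The reciprocal is maximized instead, because
    \<open>q\<close> vanishes on the circle and \<open>v\<close> does not.\<close>
  have "continuous_on (cball y R) (\<lambda>x. (q x)\<^sup>2 / v x)"
    unfolding q_def by (intro continuous_intros cont) (use pos in \<open>auto simp: less_imp_neq[symmetric]\<close>)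
  from continuous_attains_sup[OF compact_cball _ this]
  obtain z where z: "z \<in> cball y R" and zmax: "\<And>x. x \<in> cball y R \<Longrightarrow> (q x)\<^sup>2 / v x \<le> (q z)\<^sup>2 / v z"
    using R by auto
  have "q y = 1" by (simp add: q_def)
  have "0 < (q y)\<^sup>2 / v y" using pos \<open>q y = 1\<close> by simp
  also have "\<dots> \<le> (q z)\<^sup>2 / v z" using zmax R by simp
  finally have "q z \<noteq> 0" by auto
  then have qz: "q z > 0" using q0' z by force
  then have zR: "dist y z < R" using q0 by simp
  define \<mu> where "\<mu> = v z / (q z)\<^sup>2"
  have \<mu>: "\<mu> > 0" using pos qz by (simp add: \<mu>_def)
  have vz: "v z = \<mu> * (q z)\<^sup>2" using qz by (simp add: \<mu>_def)
  have vx: "\<mu> * (q x)\<^sup>2 \<le> v x" if "x \<in> cball y R" for x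
    using zmax[OF that] pos[of x] pos[of z] qz by (simp add: \<mu>_def field_simps)
  have vy: "\<mu> \<le> v y" using vx[of y] R \<open>q y = 1\<close> by simp
  have "\<forall>\<^sub>F x in nhds z. x \<in> ball y R" using zR by (intro eventually_nhds_in_open) auto
  then have ev: "\<forall>\<^sub>F x in nhds z. \<mu> * (q x * q x) - v x \<le> \<mu> * (q z * q z) - v z"
    by eventually_elim (use vx vz in \<open>auto simp: power2_eq_square\<close>)
  define r where "r = (z - y) \<bullet> (z - y)"
  have r: "r = R\<^sup>2 * (1 - q z)" using R by (simp add: q_def r_def field_simps)
  note j = has_jet_diff[OF has_jet_cmult[OF has_jet_mult[OF jq jq], of \<mu>] jet[of z]]
  define p where "p = z - y"
  have r_p: "r = p \<bullet> p" by (simp add: r_def p_def)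
  from has_jet_local_max(2)[OF j ev, folded p_def]
  have "\<mu> * (- 8 * q z / R\<^sup>2 + 8 * r / R^4) \<le> v z * ((v z)\<^sup>2 - a z)"
    by (simp add: r_p power4_eq_xxxx power2_eq_square algebra_simps)
  also have "8 * r / R^4 = 8 * (1 - q z) / R\<^sup>2" unfolding r using R by (simp add: field_simps power4_eq_xxxx power2_eq_square)
  finally have "\<mu> * (8 * (1 - 2 * q z) / R\<^sup>2) \<le> \<mu> * ((q z)\<^sup>2 * ((v z)\<^sup>2 - a z))"
    unfolding vz by (simp add: algebra_simps add_divide_distrib diff_divide_distrib)
  then have *: "8 * (1 - 2 * q z) / R\<^sup>2 \<le> (q z)\<^sup>2 * ((v z)\<^sup>2 - a z)"
    using \<mu> by (rule mult_left_le_imp_le)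
  \<comment> \<open>This is \<open>(1 - q z)\<^sup>2 \<ge> 0\<close>. It turns the left side into a
    multiple of \<open>(q z)\<^sup>2\<close>, which then cancels however close the touching point is
    to the circle.\<close>
  have "- (q z)\<^sup>2 \<le> 1 - 2 * q z" using zero_le_power2[of "1 - q z"] by (simp add: power2_eq_square algebra_simps)
  then have "8 * (- (q z)\<^sup>2) / R\<^sup>2 \<le> 8 * (1 - 2 * q z) / R\<^sup>2"
    by (intro divide_right_mono mult_left_mono) auto
  moreover have "8 * (- (q z)\<^sup>2) / R\<^sup>2 = (q z)\<^sup>2 * (- 8 / R\<^sup>2)" by simp
  ultimately have "(q z)\<^sup>2 * (- 8 / R\<^sup>2) \<le> 8 * (1 - 2 * q z) / R\<^sup>2" by linarith
  with * have "(q z)\<^sup>2 * (- 8 / R\<^sup>2) \<le> (q z)\<^sup>2 * ((v z)\<^sup>2 - a z)" by linarith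
  moreover have "0 < (q z)\<^sup>2" using qz by simp
  ultimately have "- 8 / R\<^sup>2 \<le> (v z)\<^sup>2 - a z" by (rule mult_left_le_imp_le)
  then have 1: "m - 8 / R\<^sup>2 \<le> (v z)\<^sup>2" using m[OF zR] by simp
  have "(q z)\<^sup>2 \<le> 1" using qz qle[of z] by (simp add: power_le_one)
  then have "v z \<le> \<mu>" using \<mu> vz by (simp add: mult_left_le)
  then have "v z \<le> v y" using vy by simp
  then have "(v z)\<^sup>2 \<le> (v y)\<^sup>2" using pos[of z] by (intro power_mono) auto
  with 1 show ?thesis by simp
qed

lemma upper_bound:
  assumes R: "R > 0" and m: "\<And>x. dist y x < R \<Longrightarrow> a x \<le> m" and m0: "m \<ge> 0"
  shows "(v y)\<^sup>2 \<le> m + 8 / R\<^sup>2"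
proof -
  define q where "q = (\<lambda>x. 1 - (1 / R\<^sup>2) * ((x - y) \<bullet> (x - y)))"
  have jq: "has_jet q x (0 - (1 / R\<^sup>2) *\<^sub>R (2 *\<^sub>R (x - y))) (0 - (1 / R\<^sup>2) * 4)" for x
    unfolding q_def by (intro has_jet_diff has_jet_cmult has_jet_const has_jet_dist_sq)
  have qle: "q x \<le> 1" for x using R by (simp add: q_def)
  have q0: "q x > 0 \<longleftrightarrow> dist y x < R" for x
  proof -
    have "q x > 0 \<longleftrightarrow> (dist y x)\<^sup>2 < R\<^sup>2"
      using R by (simp add: q_def field_simps dist_norm norm_minus_commute power2_norm_eq_inner)
    then show ?thesis using R by (metis less_imp_le power2_less_imp_less power_strict_mono zero_le_dist zero_less_numeral)
  qed
  have "continuous_on (cball y R) (\<lambda>x. v x * q x)"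
    unfolding q_def by (intro continuous_intros cont)
  from continuous_attains_sup[OF compact_cball _ this]
  obtain z where z: "z \<in> cball y R" and zmax: "\<And>x. x \<in> cball y R \<Longrightarrow> v x * q x \<le> v z * q z"
    using R by auto
  have "q y = 1" by (simp add: q_def)
  then have vy: "v y \<le> v z * q z" using zmax[of y] R by simp
  then have "0 < v z * q z" using pos[of y] by linarith
  then have qz: "q z > 0" using pos[of z] by (simp add: zero_less_mult_iff)
  then have zR: "dist y z < R" using q0 by simp
  have "\<forall>\<^sub>F x in nhds z. x \<in> ball y R" using zR by (intro eventually_nhds_in_open) auto
  then have ev: "\<forall>\<^sub>F x in nhds z. v x * q x \<le> v z * q z"
    by eventually_elim (use zmax in auto)
  define r where "r = (z - y) \<bullet> (z - y)"
  have r: "r = R\<^sup>2 * (1 - q z)" using R by (simp add: q_def r_def field_simps)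
  note j = has_jet_mult[OF jet[of z] jq[of z]]
  define p where "p = z - y"
  from has_jet_local_max(1)[OF j ev]
  \<comment> \<open>The first order condition makes \<open>g z\<close> radial, so that after one
    more multiplication by \<open>q z\<close> the cross term in the Laplacian of
    \<open>v * q\<close> depends on \<open>v z\<close> and \<open>q z\<close> alone.\<close>
  have grad: "q z *\<^sub>R g z = (2 * v z / R\<^sup>2) *\<^sub>R (z - y)"
    by (simp add: algebra_simps)
  have dot: "q z * (g z \<bullet> p) = 2 * v z * (1 - q z)"
  proof -
    have "q z * (g z \<bullet> p) = (q z *\<^sub>R g z) \<bullet> p" by simp
    also have "\<dots> = (2 * v z / R\<^sup>2) * r" unfolding grad by (simp add: r_def p_def)
    finally show ?thesis unfolding r using R by simp
  qed
  from has_jet_local_max(2)[OF j ev, folded p_def]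
  have "q z * (v z * ((v z)\<^sup>2 - a z)) \<le> 4 * v z / R\<^sup>2 + 4 * (g z \<bullet> p) / R\<^sup>2"
    by (simp add: algebra_simps)
  then have "q z * (q z * (v z * ((v z)\<^sup>2 - a z))) \<le> q z * (4 * v z / R\<^sup>2 + 4 * (g z \<bullet> p) / R\<^sup>2)"
    using qz by (intro mult_left_mono) auto
  also have "\<dots> = 4 * v z * q z / R\<^sup>2 + 4 * (q z * (g z \<bullet> p)) / R\<^sup>2"
    by (simp add: algebra_simps)
  also have "\<dots> = v z * ((8 - 4 * q z) / R\<^sup>2)" unfolding dot by (simp add: algebra_simps add_divide_distrib diff_divide_distrib)
  finally have "v z * ((q z)\<^sup>2 * ((v z)\<^sup>2 - a z)) \<le> v z * ((8 - 4 * q z) / R\<^sup>2)"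
    by (simp add: power2_eq_square algebra_simps)
  then have "(q z)\<^sup>2 * ((v z)\<^sup>2 - a z) \<le> (8 - 4 * q z) / R\<^sup>2"
    using pos[of z] by (rule mult_left_le_imp_le)
  also have "\<dots> \<le> 8 / R\<^sup>2" using qz by (intro divide_right_mono) auto
  finally have 1: "(v z * q z)\<^sup>2 \<le> (q z)\<^sup>2 * a z + 8 / R\<^sup>2"
    by (simp add: power_mult_distrib algebra_simps)
  have "(q z)\<^sup>2 * a z \<le> (q z)\<^sup>2 * m" using m[OF zR] by (intro mult_left_mono) auto
  \<comment> \<open>Here \<open>m \<ge> 0\<close> enters: the factor
    \<open>(q z)\<^sup>2 \<le> 1\<close> may be dropped.\<close>
  also have "\<dots> \<le> 1 * m" using qz qle[of z] m0 by (intro mult_right_mono) (auto simp: power_le_one)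
  finally have 2: "(v z * q z)\<^sup>2 \<le> m + 8 / R\<^sup>2" using 1 by simp
  have "(v y)\<^sup>2 \<le> (v z * q z)\<^sup>2" using vy pos[of y] by (intro power_mono) auto
  with 2 show ?thesis by simp
qed

end

section \<open>Interior gradient estimate\<close>

text \<open>Brandt's argument: the odd part of \<open>u\<close> in the \<open>i\<close>-th coordinate vanishes on the axis of symmetry and is
  dominated by an explicit quadratic barrier on the half square.\<close>

lemma partial_deriv_bound_one_sided:
  fixes u :: "real^2 \<Rightarrow> real"
  assumes d: "d > 0" and ij: "i \<noteq> j"
    and jet: "\<And>x. \<bar>(x - y) $ i\<bar> \<le> d \<Longrightarrow> \<bar>(x - y) $ j\<bar> \<le> d \<Longrightarrow> has_jet u x (g x) (l x) \<and> \<bar>u x\<bar> \<le> M \<and> \<bar>l x\<bar> < F"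
  shows "g y $ i \<le> 2 * M / d + d * F / 2"
proof -
  define e where "e = (axis i 1 :: real^2)"
  define f where "f = (axis j 1 :: real^2)"
  have veq: "x = (x $ i) *\<^sub>R e + (x $ j) *\<^sub>R f" for x :: "real^2"
  proof -
    have "x $ k = ((x $ i) *\<^sub>R e + (x $ j) *\<^sub>R f) $ k" for k
    proof -
      have "k = i \<or> k = j" using ij exhaust_2[of i] exhaust_2[of j] exhaust_2[of k] by auto
      then show ?thesis using ij by (auto simp: e_def f_def axis_def)
    qed
    then show ?thesis unfolding vec_eq_iff by blast
  qed
  have [simp]: "e $ i = 1" "e $ j = 0" "f $ i = 0" "f $ j = 1" using ij by (auto simp: e_def f_def axis_def)
  have xe: "x \<bullet> e = x $ i" "x \<bullet> f = x $ j" for x by (simp_all add: e_def f_def inner_axis)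
  have M: "M \<ge> 0" using jet[of y] d by force
  have F: "F > 0" using jet[of y] d by force
  \<comment> \<open>\<open>A\<close> reflects the \<open>i\<close>-th coordinate, so that
    \<open>w\<close> below is the odd part of \<open>u\<close> about \<open>y\<close> in that
    coordinate.\<close>
  define A where "A = (\<lambda>x :: real^2. x - (2 * (x \<bullet> e)) *\<^sub>R e)"
  have Ai: "A x $ i = - (x $ i)" "A x $ j = x $ j" for x by (simp_all add: A_def xe)
  have A: "linear A" by (auto simp: A_def intro!: linearI simp: algebra_simps inner_add_left)
  have AA: "A (A x) = 1 *\<^sub>R x" for x using veq[of "A (A x)"] veq[of x] by (simp add: Ai)
  have ee: "e \<bullet> e = 1" "e \<bullet> f = 0" by (simp_all add: xe)
  have Asym: "A x \<bullet> z = x \<bullet> A z" for x z by (simp add: A_def inner_diff_left inner_diff_right inner_commute)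
  have Adiag: "\<exists>s. A (axis k 1) = s *\<^sub>R axis k 1" for k
  proof (cases "k = i")
    case True then show ?thesis by (intro exI[of _ "-1"]) (simp add: A_def e_def inner_axis scaleR_2)
  next
    case False then show ?thesis by (intro exI[of _ "1"]) (simp add: A_def e_def inner_axis_axis)
  qed
  \<comment> \<open>The bracket after \<open>M / d\<^sup>2\<close> is harmonic and at least
    \<open>d\<^sup>2\<close> on the three outer sides of the half square \<open>Q\<close>, where
    \<open>w \<le> M\<close>; on the fourth side \<open>w\<close> vanishes. The last summand is
    nonnegative on \<open>Q\<close> and has Laplacian \<open>- F\<close>.\<close>
  define \<psi> where "\<psi> = (\<lambda>x. M / d\<^sup>2 * ((x \<bullet> f) * (x \<bullet> f) + (x \<bullet> e) * (2 * d - x \<bullet> e)) + F / 2 * ((x \<bullet> e) * (d - x \<bullet> e)))"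
  have j\<psi>: "\<exists>P. has_jet \<psi> x P (- F)" for x
  proof -
    have "has_jet (\<lambda>x. M / d\<^sup>2 * ((x \<bullet> f) * (x \<bullet> f) + (x \<bullet> e) * (2 * d - x \<bullet> e)) + F / 2 * ((x \<bullet> e) * (d - x \<bullet> e))) x
     ((M / d\<^sup>2) *\<^sub>R (((x \<bullet> f) *\<^sub>R f + (x \<bullet> f) *\<^sub>R f) + ((x \<bullet> e) *\<^sub>R (0 - e) + (2 * d - x \<bullet> e) *\<^sub>R e)) +
      (F / 2) *\<^sub>R ((x \<bullet> e) *\<^sub>R (0 - e) + (d - x \<bullet> e) *\<^sub>R e))
     (M / d\<^sup>2 * (((x \<bullet> f) * 0 + 2 * (f \<bullet> f) + (x \<bullet> f) * 0) + ((x \<bullet> e) * (0 - 0) + 2 * (e \<bullet> (0 - e)) + (2 * d - x \<bullet> e) * 0)) +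
      (F / 2) * ((x \<bullet> e) * (0 - 0) + 2 * (e \<bullet> (0 - e)) + (d - x \<bullet> e) * 0))"
      by (intro has_jet_add has_jet_cmult has_jet_mult has_jet_diff has_jet_const has_jet_inner)
    then show ?thesis unfolding \<psi>_def by (auto simp: xe)
  qed
  define w where "w = (\<lambda>x. 1/2 * (u (y + x) - u (y + A x)))"
  have jw: "\<exists>k. has_jet w x ((1/2) *\<^sub>R (g (y + x) - A (g (y + A x)))) k \<and> \<bar>k\<bar> < F"
    if "\<bar>x $ i\<bar> \<le> d" "\<bar>x $ j\<bar> \<le> d" for x
  proof -
    have 1: "has_jet u (y + x) (g (y + x)) (l (y + x))" "\<bar>l (y + x)\<bar> < F"
      using jet[of "y + x"] that by auto
    have 2: "has_jet u (y + A x) (g (y + A x)) (l (y + A x))" "\<bar>l (y + A x)\<bar> < F"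
      using jet[of "y + A x"] that by (auto simp: Ai)
    have "has_jet (\<lambda>x. u (y + x)) x (g (y + x)) (l (y + x))"
      using has_jet_scale[of u y 1 x] 1 by simp
    moreover have "has_jet (\<lambda>x. u (y + A x)) x (A (g (y + A x))) (l (y + A x))"
      using has_jet_compose_linear[OF 2(1) A Asym AA Adiag] by simp
    ultimately have "has_jet w x ((1/2) *\<^sub>R (g (y + x) - A (g (y + A x)))) (1/2 * (l (y + x) - l (y + A x)))"
      unfolding w_def by (intro has_jet_cmult has_jet_diff)
    then show ?thesis using 1(2) 2(2) by (intro exI conjI) (assumption, auto simp: abs_less_iff)
  qed
  have wM: "w x \<le> M" if "\<bar>x $ i\<bar> \<le> d" "\<bar>x $ j\<bar> \<le> d" for x
    using jet[of "y + x"] jet[of "y + A x"] that by (auto simp: Ai w_def abs_le_iff)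
  define Q where "Q = {x :: real^2. 0 \<le> x \<bullet> e \<and> x \<bullet> e \<le> d \<and> - d \<le> x \<bullet> f \<and> x \<bullet> f \<le> d}"
  have Qi: "\<bar>x $ i\<bar> \<le> d" "\<bar>x $ j\<bar> \<le> d" if "x \<in> Q" for x using that by (auto simp: Q_def xe)
  have "compact Q"
  proof -
    have "Q = {x. 0 \<le> x \<bullet> e} \<inter> {x. x \<bullet> e \<le> d} \<inter> {x. - d \<le> x \<bullet> f} \<inter> {x. x \<bullet> f \<le> d}" by (auto simp: Q_def)
    then have "closed Q" by (auto intro!: closed_Collect_le closed_Int continuous_intros)
    moreover have "bounded Q"
    proof (rule boundedI)
      fix x assume x: "x \<in> Q"
      have "norm x \<le> norm ((x $ i) *\<^sub>R e) + norm ((x $ j) *\<^sub>R f)" using veq[of x] norm_triangle_ineq by metis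
      also have "\<dots> \<le> d + d" using Qi[OF x] by (simp add: e_def f_def)
      finally show "norm x \<le> d + d" .
    qed
    ultimately show ?thesis by (simp add: compact_eq_bounded_closed)
  qed
  moreover have "0 \<in> Q" using d by (simp add: Q_def)
  moreover have "continuous_on Q (\<lambda>x. w x - \<psi> x)"
  proof -
    have "isCont (\<lambda>x. w x - \<psi> x) x" if "x \<in> Q" for x
      using jw[OF Qi[OF that]] j\<psi>[of x] by (auto intro!: continuous_diff intro: has_jet_isCont)
    then show ?thesis by (simp add: continuous_at_imp_continuous_on)
  qed
  ultimately obtain z where z: "z \<in> Q" and zmax: "\<And>x. x \<in> Q \<Longrightarrow> w x - \<psi> x \<le> w z - \<psi> z"
    using continuous_attains_sup[of Q] by blast
  have \<psi>0: "F / 2 * (x \<bullet> e * (d - x \<bullet> e)) \<ge> 0" if "x \<in> Q" for x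
    using that F by (auto simp: Q_def)
  have "w z \<le> \<psi> z"
  proof (rule ccontr)
    assume "\<not> w z \<le> \<psi> z"
    then have c: "\<psi> z < w z" by simp
    have "z \<bullet> e \<noteq> 0"
    proof
      assume 0: "z \<bullet> e = 0"
      then have "A z = z" by (simp add: A_def)
      then have "w z = 0" by (simp add: w_def)
      moreover have "\<psi> z \<ge> 0" unfolding \<psi>_def 0 using M by simp
      ultimately show False using c by simp
    qed
    have big: False if "(z \<bullet> f) * (z \<bullet> f) + (z \<bullet> e) * (2 * d - z \<bullet> e) \<ge> d\<^sup>2"
    proof -
      have "M / d\<^sup>2 * d\<^sup>2 \<le> M / d\<^sup>2 * ((z \<bullet> f) * (z \<bullet> f) + (z \<bullet> e) * (2 * d - z \<bullet> e))"
        using that M d by (intro mult_left_mono) auto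
      then have "M \<le> \<psi> z" unfolding \<psi>_def using \<psi>0[OF z] d by simp
      then show False using wM[OF Qi[OF z]] c by simp
    qed
    have "z \<bullet> e \<noteq> d" using big by (auto simp: power2_eq_square algebra_simps)
    have nn: "(z \<bullet> e) * (2 * d - z \<bullet> e) \<ge> 0" using z d by (auto simp: Q_def)
    have "z \<bullet> f \<noteq> d" "z \<bullet> f \<noteq> - d" using big nn by (auto simp: power2_eq_square)
    define U where "U = {x. 0 < x \<bullet> e} \<inter> {x. x \<bullet> e < d} \<inter> {x. - d < x \<bullet> f} \<inter> {x. x \<bullet> f < d}"
    have "open U" unfolding U_def by (intro open_Int open_Collect_less continuous_intros)
    moreover have "z \<in> U" using z \<open>z \<bullet> e \<noteq> d\<close> \<open>z \<bullet> e \<noteq> 0\<close> \<open>z \<bullet> f \<noteq> d\<close> \<open>z \<bullet> f \<noteq> - d\<close> by (auto simp: U_def Q_def)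
    moreover have "U \<subseteq> Q" by (auto simp: U_def Q_def)
    ultimately have ev: "\<forall>\<^sub>F x in nhds z. w x - \<psi> x \<le> w z - \<psi> z"
      unfolding eventually_nhds using zmax by blast
    obtain k where k: "has_jet w z ((1/2) *\<^sub>R (g (y + z) - A (g (y + A z)))) k" "\<bar>k\<bar> < F" using jw[OF Qi[OF z]] by blast
    obtain P where P: "has_jet \<psi> z P (- F)" using j\<psi> by blast
    \<comment> \<open>The Laplacian of \<open>w - \<psi>\<close> is \<open>k + F\<close>, which is
      positive because the bound on \<open>k\<close> is strict.\<close>
    from has_jet_local_max(2)[OF has_jet_diff[OF k(1) P] ev] k(2) show False by simp
  qed
  then have le: "w x \<le> \<psi> x" if "x \<in> Q" for x using zmax[OF that] by simp
  define S where "S = 2 * M / d + d * F / 2"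
  have line: "w (s *\<^sub>R e) \<le> S * s" if "0 < s" "s \<le> d" for s
  proof -
    have "w (s *\<^sub>R e) \<le> \<psi> (s *\<^sub>R e)" using that by (intro le) (auto simp: Q_def ee)
    also have "\<dots> = M / d\<^sup>2 * (s * (2 * d - s)) + F / 2 * (s * (d - s))" by (simp add: \<psi>_def ee)
    also have "\<dots> \<le> M / d\<^sup>2 * (s * (2 * d)) + F / 2 * (s * d)"
      using that M F d by (intro add_mono mult_left_mono) auto
    also have "\<dots> = S * s" using d by (simp add: S_def field_simps power2_eq_square)
    finally show ?thesis .
  qed
  \<comment> \<open>At the origin the gradient of \<open>w\<close> is the \<open>i\<close>-th
    partial derivative of \<open>u\<close> at \<open>y\<close> times \<open>e\<close>. As
    \<open>w\<close> vanishes there and lies below the line of slope \<open>S\<close>, this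
    derivative is at most \<open>S\<close>.\<close>
  obtain k where "has_jet w 0 ((1/2) *\<^sub>R (g y - A (g y))) k"
    using jw[of 0] d linear_0[OF A] by auto
  moreover have "(1/2) *\<^sub>R (g y - A (g y)) = (g y $ i) *\<^sub>R e" by (simp add: A_def xe)
  ultimately have jet0: "has_jet w 0 ((g y $ i) *\<^sub>R e) k" by simp
  have dw: "(w has_derivative (\<lambda>v. (g y $ i) * (e \<bullet> v))) (at 0)"
    using has_jet_derivative[OF jet0] by simp
  have "((\<lambda>s. s *\<^sub>R e) has_derivative (\<lambda>s. s *\<^sub>R e)) (at (0::real))" by (auto intro!: derivative_eq_intros)
  from has_derivative_compose[OF this, of w "\<lambda>v. (g y $ i) * (e \<bullet> v)"] dw
  have "((\<lambda>s. w (s *\<^sub>R e)) has_real_derivative (g y $ i)) (at 0)"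
    by (simp add: has_field_derivative_def ee mult_commute_abs)
  then have "((\<lambda>s. S * s - w (s *\<^sub>R e)) has_real_derivative (S - g y $ i)) (at 0)"
    by (auto intro!: derivative_eq_intros)
  moreover have "w 0 = 0" using linear_0[OF A] by (simp add: w_def)
  ultimately show ?thesis unfolding S_def[symmetric]
  proof -
    assume D: "((\<lambda>s. S * s - w (s *\<^sub>R e)) has_real_derivative (S - g y $ i)) (at 0)" and w0: "w 0 = 0"
    show "g y $ i \<le> S"
    proof (rule ccontr)
      assume "\<not> g y $ i \<le> S"
      then have "S - g y $ i < 0" by simp
      from DERIV_neg_dec_right[OF D this] obtain d' where d': "d' > 0"
        "\<And>h. h > 0 \<Longrightarrow> h < d' \<Longrightarrow> S * h < w (h *\<^sub>R e)" using w0 by auto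
      define s where "s = min d' d / 2"
      have "0 < s" "s < d'" "s \<le> d" using d d' by (auto simp: s_def)
      then show False using line[of s] d'(2)[of s] by simp
    qed
  qed
qed

text \<open>The one sided bound is applied to \<open>u\<close> and to \<open>- u\<close> in both
  coordinates, and the two components are added. A square of half side \<open>d\<close> lies in the
  ball of radius \<open>2 * d\<close>.\<close>

lemma gradient_bound:
  fixes u :: "real^2 \<Rightarrow> real"
  assumes d: "d > 0" 
    and jet: "\<And>x. dist y x \<le> 2 * d \<Longrightarrow> has_jet u x (g x) (l x) \<and> \<bar>u x\<bar> \<le> M \<and> \<bar>l x\<bar> < F"
  shows "norm (g y) \<le> 4 * M / d + d * F"
proof -
  have sq: "dist y x \<le> 2 * d" if "\<bar>(x - y) $ i\<bar> \<le> d" "\<bar>(x - y) $ j\<bar> \<le> d" "i \<noteq> j" for x i j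
  proof -
    have "norm (y - x) \<le> (\<Sum>k\<in>UNIV. \<bar>(y - x) $ k\<bar>)" by (rule norm_le_l1_cart)
    also have "\<dots> \<le> (\<Sum>k\<in>(UNIV::2 set). d)"
    proof (rule sum_mono)
      fix k :: 2
      have "k = i \<or> k = j" using that(3) exhaust_2[of i] exhaust_2[of j] exhaust_2[of k] by auto
      then show "\<bar>(y - x) $ k\<bar> \<le> d" using that by (auto simp: abs_minus_commute)
    qed
    finally show ?thesis by (simp add: dist_norm)
  qed
  have "\<bar>g y $ i\<bar> \<le> 2 * M / d + d * F / 2" for i
  proof -
    obtain j where ij: "i \<noteq> j" using exhaust_2[of i] by (metis one_neq_zero)
    have 1: "g y $ i \<le> 2 * M / d + d * F / 2"
      by (rule partial_deriv_bound_one_sided[OF d ij, of y u g l]) (use jet sq ij in blast)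
    have 2: "(- g y) $ i \<le> 2 * M / d + d * F / 2"
    proof (rule partial_deriv_bound_one_sided[OF d ij, of y "\<lambda>x. - u x" "\<lambda>x. - g x" "\<lambda>x. - l x"])
      fix x assume "\<bar>(x - y) $ i\<bar> \<le> d" "\<bar>(x - y) $ j\<bar> \<le> d"
      then have "dist y x \<le> 2 * d" using sq ij by blast
      then show "has_jet (\<lambda>x. - u x) x (- g x) (- l x) \<and> \<bar>- u x\<bar> \<le> M \<and> \<bar>- l x\<bar> < F"
        using jet has_jet_cmult[of u x "g x" "l x" "-1"] by auto
    qed
    show ?thesis using 1 2 by (simp add: abs_le_iff)
  qed
  then have "(\<Sum>i\<in>UNIV. \<bar>g y $ i\<bar>) \<le> (\<Sum>i\<in>(UNIV :: 2 set). 2 * M / d + d * F / 2)" by (intro sum_mono)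
  then show ?thesis using norm_le_l1_cart[of "g y"] by simp
qed

section \<open>The rescaled problem near a boundary point\<close>

text \<open>The base point on the boundary curve is moved to the origin and \<open>e\<close> is the
  outward normal there. Control of \<open>a\<close> is local, in the ball of radius
  \<open>\<rho>\<close>. The constants \<open>c\<close> and \<open>C\<close> are invariant under the
  rescaling, so bounds in terms of them alone are uniform.\<close>

locale front = ground_state +
  fixes e :: "real^2" and \<rho> c C :: real
  assumes c: "c > 0" and C: "C > 0" and e: "norm e = 1"
    and lip: "x \<in> ball 0 \<rho> \<Longrightarrow> y \<in> ball 0 \<rho> \<Longrightarrow> \<bar>a x - a y\<bar> \<le> C * dist x y"
    and decr: "x \<in> ball 0 \<rho> \<Longrightarrow> x + h *\<^sub>R e \<in> ball 0 \<rho> \<Longrightarrow> h \<ge> 0 \<Longrightarrow> a (x + h *\<^sub>R e) \<le> a x - c * h"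
begin

section \<open>Difference quotients in the normal direction\<close>

definition quot :: "real \<Rightarrow> real^2 \<Rightarrow> real" where
  "quot h x = (v (x + h *\<^sub>R e) - v x) / h"

lemma ee: "e \<bullet> e = 1" using e by (simp add: norm_eq_1)

lemma line_derivative: "((\<lambda>s. v (x + s *\<^sub>R e)) has_real_derivative (g (x + s *\<^sub>R e) \<bullet> e)) (at s)"
proof -
  have "((\<lambda>s. x + s *\<^sub>R e) has_derivative (\<lambda>t. t *\<^sub>R e)) (at s)" by (auto intro!: derivative_eq_intros)
  from has_derivative_compose[OF this has_jet_derivative[OF jet]]
  show ?thesis by (simp add: has_field_derivative_def mult_commute_abs)
qed

lemma quot_le:
  assumes "h > 0" "\<And>s. 0 < s \<Longrightarrow> s < h \<Longrightarrow> g (x + s *\<^sub>R e) \<bullet> e \<le> B"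
  shows "quot h x \<le> B"
proof -
  have "\<exists>z>0. z < h \<and> v (x + h *\<^sub>R e) - v (x + 0 *\<^sub>R e) = (h - 0) * (g (x + z *\<^sub>R e) \<bullet> e)"
    using MVT2[of 0 h "\<lambda>s. v (x + s *\<^sub>R e)" "\<lambda>s. g (x + s *\<^sub>R e) \<bullet> e"] assms(1) line_derivative by auto
  then obtain z where "0 < z" "z < h" "v (x + h *\<^sub>R e) - v x = h * (g (x + z *\<^sub>R e) \<bullet> e)" by auto
  then show ?thesis using assms by (simp add: quot_def)
qed

lemma derivative_le_of_quot:
  assumes "\<forall>\<^sub>F h in at_right 0. quot h x \<le> B"
  shows "g x \<bullet> e \<le> B"
proof (rule tendsto_upperbound[OF _ assms])
  have "((\<lambda>h. (v (x + h *\<^sub>R e) - v (x + 0 *\<^sub>R e)) / (h - 0)) \<longlongrightarrow> g (x + 0 *\<^sub>R e) \<bullet> e) (at 0)"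
    using line_derivative[of x 0] unfolding has_field_derivative_iff by simp
  then show "((\<lambda>h. quot h x) \<longlongrightarrow> g x \<bullet> e) (at_right 0)"
    by (auto simp: quot_def filterlim_at_split)
qed auto

text \<open>Subtracting the equations at the two points, the cubic terms factor as a difference of
  cubes. The remaining term is the source: by \<open>decr\<close> it is at least
  \<open>c * v (x + h *\<^sub>R e)\<close> when \<open>h > 0\<close> and both points lie in the
  ball.\<close>

lemma jet_quot:
  assumes "h \<noteq> 0"
  shows "has_jet (quot h) x ((1 / h) *\<^sub>R (g (x + h *\<^sub>R e) - g x))
    (quot h x * ((v (x + h *\<^sub>R e))\<^sup>2 + v (x + h *\<^sub>R e) * v x + (v x)\<^sup>2 - a x) + v (x + h *\<^sub>R e) * (a x - a (x + h *\<^sub>R e)) / h)"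
proof -
  have "has_jet (\<lambda>x. (1 / h) * (v (x + h *\<^sub>R e) - v x)) x ((1 / h) *\<^sub>R (g (x + h *\<^sub>R e) - g x))
    ((1 / h) * (v (x + h *\<^sub>R e) * ((v (x + h *\<^sub>R e))\<^sup>2 - a (x + h *\<^sub>R e)) - v x * ((v x)\<^sup>2 - a x)))"
    by (intro has_jet_cmult has_jet_diff has_jet_shift jet)
  moreover have "(\<lambda>x. (1 / h) * (v (x + h *\<^sub>R e) - v x)) = quot h" by (auto simp: quot_def)
  moreover have "(1 / h) * (v (x + h *\<^sub>R e) * ((v (x + h *\<^sub>R e))\<^sup>2 - a (x + h *\<^sub>R e)) - v x * ((v x)\<^sup>2 - a x)) =
    quot h x * ((v (x + h *\<^sub>R e))\<^sup>2 + v (x + h *\<^sub>R e) * v x + (v x)\<^sup>2 - a x) + v (x + h *\<^sub>R e) * (a x - a (x + h *\<^sub>R e)) / h"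
    using assms by (simp add: quot_def power2_eq_square divide_simps) (simp add: algebra_simps)
  ultimately show ?thesis by simp
qed

lemma lip_ball:
  assumes "norm x + r \<le> \<rho>" "dist x y < r"
  shows "\<bar>a x - a y\<bar> \<le> C * r"
proof -
  have "norm y \<le> norm x + dist x y" by (metis dist_commute dist_norm norm_triangle_sub)
  then have "\<bar>a x - a y\<bar> \<le> C * dist x y" using assms
    by (intro lip) (simp, smt (verit) zero_le_dist, simp)
  also have "\<dots> \<le> C * r" using assms C by (intro mult_left_mono) auto
  finally show ?thesis .
qed

section \<open>The derivative bound where \<open>a\<close> is large\<close>

text \<open>On a ball of radius comparable to \<open>\<alpha>\<close> the linearized operator is coercive of order \<open>\<alpha>\<close>.  Only
  a crude bound of order \<open>\<alpha>\<close> is available for the difference quotient on the boundary of that ball, but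
  the quadratic part of the barrier \<open>B\<close> absorbs it once \<open>\<alpha>\<close> is large.\<close>

lemma interior_derivative_bound:
  assumes \<alpha>_def: "\<alpha> = a y" and \<alpha>: "\<alpha> > 0" and y: "norm y + \<alpha> / (4 * C) \<le> \<rho>"
    and big: "200 * C \<le> \<alpha> * sqrt \<alpha>" "c \<le> \<alpha> * sqrt \<alpha>" "45056 * C\<^sup>2 / c < \<alpha> * sqrt \<alpha>"
  shows "g y \<bullet> e \<le> - (c / 16) / sqrt \<alpha>"
proof -
  \<comment> \<open>On the ball of radius \<open>k * R\<close> about \<open>y\<close> with
    \<open>k \<le> 4\<close>, the Lipschitz bound keeps \<open>a\<close> within
    \<open>k * \<alpha> / 16\<close> of \<open>\<alpha>\<close>.\<close>
  define R where "R = \<alpha> / (16 * C)"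
  have R: "R > 0" using \<alpha> C by (simp add: R_def)
  have CR: "C * R = \<alpha> / 16" using C by (simp add: R_def)
  have y': "norm y + 4 * R \<le> \<rho>" using y by (simp add: R_def)
  define s where "s = sqrt \<alpha>"
  have s: "s > 0" and ss: "s * s = \<alpha>" using \<alpha> by (auto simp: s_def)
  have R2: "8 / R\<^sup>2 \<le> \<alpha> / 16"
  proof -
    have "(200 * C)\<^sup>2 \<le> (\<alpha> * s)\<^sup>2" using big(1) C by (intro power_mono) (auto simp: s_def)
    also have "(\<alpha> * s)\<^sup>2 = \<alpha> * \<alpha> * \<alpha>" using ss by (simp add: power2_eq_square algebra_simps)
    finally have "40000 * (C * C) \<le> \<alpha> * \<alpha> * \<alpha>" by (simp add: power2_eq_square)
    moreover have "C * C > 0" using C by simp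
    ultimately have "32768 * (C * C) \<le> \<alpha> * \<alpha> * \<alpha>" by linarith
    then show ?thesis using \<alpha> C by (simp add: R_def field_simps power2_eq_square)
  qed
  have anear: "\<bar>a x - \<alpha>\<bar> \<le> k * (\<alpha> / 16)" if "dist y x < k * R" "k \<le> 4" for x k
  proof -
    have "k * R \<le> 4 * R" using that R by (intro mult_right_mono) auto
    then have "\<bar>a y - a x\<bar> \<le> C * (k * R)" using that y' by (intro lip_ball) auto
    also have "C * (k * R) = k * (\<alpha> / 16)" by (simp flip: CR)
    finally show ?thesis by (simp add: \<alpha>_def abs_minus_commute)
  qed
  have vnear: "3/4 * \<alpha> \<le> (v x)\<^sup>2" "(v x)\<^sup>2 \<le> 5/4 * \<alpha>" if "dist y x < 2 * R" for x
  proof -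
    have 1: "13/16 * \<alpha> \<le> a z \<and> a z \<le> 19/16 * \<alpha>" if "dist x z < R" for z
    proof -
      have "\<bar>a z - \<alpha>\<bar> \<le> 3 * (\<alpha> / 16)"
        using \<open>dist y x < 2 * R\<close> that dist_triangle[of y z x] by (intro anear) auto
      then have "a z - \<alpha> \<le> 3 * (\<alpha> / 16)" "- (a z - \<alpha>) \<le> 3 * (\<alpha> / 16)" unfolding abs_le_iff by auto
      then show ?thesis by simp
    qed
    have "13/16 * \<alpha> - 8 / R\<^sup>2 \<le> (v x)\<^sup>2" using R 1 by (intro lower_bound) auto
    then show "3/4 * \<alpha> \<le> (v x)\<^sup>2" using R2 by simp
    have "(v x)\<^sup>2 \<le> 19/16 * \<alpha> + 8 / R\<^sup>2" using R 1 \<alpha> by (intro upper_bound) auto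
    then show "(v x)\<^sup>2 \<le> 5/4 * \<alpha>" using R2 by simp
  qed
  have vs: "s / 2 \<le> v x" "v x \<le> 2 * s" if "dist y x < 2 * R" for x
  proof -
    have "(s / 2)\<^sup>2 \<le> (v x)\<^sup>2" using vnear[OF that] ss \<alpha> by (simp add: power2_eq_square)
    then show "s / 2 \<le> v x" by (rule power2_le_imp_le) (use pos[of x] in simp)
    have "(v x)\<^sup>2 \<le> (2 * s)\<^sup>2" using vnear[OF that] ss \<alpha> by (simp add: power2_eq_square)
    then show "v x \<le> 2 * s" by (rule power2_le_imp_le) (use s in simp)
  qed
  \<comment> \<open>Near \<open>y\<close>, \<open>v\<close> is of order \<open>s\<close> and its
    Laplacian of order \<open>s ^ 3\<close>, so \<open>1 / s\<close> is the radius at which the two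
    terms of \<open>gradient_bound\<close> balance, both being of order
    \<open>\<alpha>\<close>.\<close>
  have grad: "norm (g x) \<le> 10 * \<alpha>" if x: "dist y x \<le> 3/2 * R" for x
  proof -
    have d: "2 * (1 / s) \<le> 3/8 * R"
    proof -
      have "200 * C \<le> \<alpha> * s" using big(1) by (simp add: s_def)
      then show ?thesis using s C by (simp add: R_def field_simps)
    qed
    have "norm (g x) \<le> 4 * (2 * s) / (1 / s) + (1 / s) * (2 * (\<alpha> * s))"
    proof (rule gradient_bound[where u=v and g=g and y=x and l="\<lambda>z. v z * ((v z)\<^sup>2 - a z)"])
      show "1 / s > 0" using s by simp
      fix z assume "dist x z \<le> 2 * (1 / s)"
      then have z: "dist y z < 2 * R" using x d R dist_triangle[of y z x] by linarith
      have "\<bar>a z - \<alpha>\<bar> \<le> 2 * (\<alpha> / 16)" by (rule anear[OF z]) simp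
      then have "\<bar>(v z)\<^sup>2 - a z\<bar> \<le> \<alpha> / 2" using vnear[OF z] by linarith
      then have "v z * \<bar>(v z)\<^sup>2 - a z\<bar> \<le> (2 * s) * (\<alpha> / 2)"
        using vs[OF z] s pos[of z] by (intro mult_mono) auto
      also have "\<dots> < 2 * (\<alpha> * s)" using s \<alpha> by simp
      finally show "has_jet v z (g z) (v z * ((v z)\<^sup>2 - a z)) \<and> \<bar>v z\<bar> \<le> 2 * s \<and> \<bar>v z * ((v z)\<^sup>2 - a z)\<bar> < 2 * (\<alpha> * s)"
        using jet vs[OF z] pos[of z] by (simp add: abs_mult)
    qed
    also have "\<dots> = 10 * \<alpha>" using s ss by (simp add: field_simps)
    finally show ?thesis .
  qed
  define b where "b = c / 16"
  have b: "b > 0" using c by (simp add: b_def)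
  have cmp: "quot h y \<le> - b / s" if h: "0 < h" "h \<le> R / 2" for h
  proof -
    have shift: "dist y (x + t *\<^sub>R e) \<le> dist y x + t" if "t \<ge> 0" for x t
      using dist_triangle[of y "x + t *\<^sub>R e" x] that e by (simp add: dist_norm)
    have qb: "quot h x \<le> 10 * \<alpha>" if x: "dist y x \<le> R" for x
    proof (rule quot_le[OF h(1)])
      fix t assume t: "0 < t" "t < h"
      have "dist y (x + t *\<^sub>R e) \<le> 3/2 * R" using shift[of t x] x t h by simp
      then have "norm (g (x + t *\<^sub>R e)) \<le> 10 * \<alpha>" by (rule grad)
      then show "g (x + t *\<^sub>R e) \<bullet> e \<le> 10 * \<alpha>" using norm_cauchy_schwarz[of "g (x + t *\<^sub>R e)" e] e by simp
    qed
    \<comment> \<open>At the centre \<open>B\<close> is the desired bound. On the circle of radius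
      \<open>R\<close> the quadratic term equals \<open>11 * \<alpha>\<close>, which exceeds the
      crude bound \<open>10 * \<alpha>\<close> by enough to pay for \<open>b / s\<close>.\<close>
    define B where "B = (\<lambda>x. - b / s + (11 * \<alpha> / R\<^sup>2) * ((x - y) \<bullet> (x - y)))"
    have jB: "has_jet B x (0 + (11 * \<alpha> / R\<^sup>2) *\<^sub>R (2 *\<^sub>R (x - y))) (0 + (11 * \<alpha> / R\<^sup>2) * 4)" for x
      unfolding B_def by (intro has_jet_add has_jet_cmult has_jet_const has_jet_dist_sq)
    have jqB: "has_jet (\<lambda>x. quot h x - B x) x ((1 / h) *\<^sub>R (g (x + h *\<^sub>R e) - g x) - (0 + (11 * \<alpha> / R\<^sup>2) *\<^sub>R (2 *\<^sub>R (x - y))))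
       (quot h x * ((v (x + h *\<^sub>R e))\<^sup>2 + v (x + h *\<^sub>R e) * v x + (v x)\<^sup>2 - a x) + v (x + h *\<^sub>R e) * (a x - a (x + h *\<^sub>R e)) / h
         - (0 + (11 * \<alpha> / R\<^sup>2) * 4))" for x
      using h by (intro has_jet_diff jet_quot jB) auto
    have "continuous_on (cball y R) (\<lambda>x. quot h x - B x)"
      using has_jet_isCont[OF jqB] by (simp add: continuous_at_imp_continuous_on)
    from continuous_attains_sup[OF compact_cball _ this]
    obtain z where z: "z \<in> cball y R" and zmax: "\<And>x. x \<in> cball y R \<Longrightarrow> quot h x - B x \<le> quot h z - B z"
      using R by auto
    have "quot h z \<le> B z"
    proof (rule ccontr)
      assume "\<not> quot h z \<le> B z"
      then have less: "B z < quot h z" by simp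
      have "dist y z \<noteq> R"
      proof
        assume "dist y z = R"
        then have "(z - y) \<bullet> (z - y) = R\<^sup>2" by (simp add: dist_norm norm_minus_commute flip: power2_norm_eq_inner)
        then have "B z = - b / s + 11 * \<alpha>" using R by (simp add: B_def)
        moreover have "b / s \<le> \<alpha>" using big(2) s c by (simp add: b_def s_def[symmetric] field_simps)
        ultimately show False using less qb[of z] z by simp
      qed
      then have zR: "dist y z < R" using z by simp
      have "\<forall>\<^sub>F x in nhds z. x \<in> ball y R" using zR by (intro eventually_nhds_in_open) auto
      then have ev: "\<forall>\<^sub>F x in nhds z. quot h x - B x \<le> quot h z - B z" by eventually_elim (use zmax in auto)
      define v1 q where "v1 = v (z + h *\<^sub>R e)" and "q = v1\<^sup>2 + v1 * v z + (v z)\<^sup>2 - a z"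
      have le: "quot h z * q + v1 * (a z - a (z + h *\<^sub>R e)) / h \<le> 44 * \<alpha> / R\<^sup>2"
        using has_jet_local_max(2)[OF jqB ev] by (simp add: q_def v1_def)
      have z1: "dist y (z + h *\<^sub>R e) < 2 * R" using shift[of h z] zR h by simp
      have z2: "dist y z < 2 * R" using zR R by simp
      have inb: "x \<in> ball 0 \<rho>" if "dist y x < 2 * R" for x
        using that y' R norm_triangle_sub[of x y] by (simp add: dist_norm norm_minus_commute)
      have "c * h \<le> a z - a (z + h *\<^sub>R e)" using decr[of z h] inb[OF z1] inb[OF z2] h by simp
      then have "v1 * (c * h) / h \<le> v1 * (a z - a (z + h *\<^sub>R e)) / h"
        using pos[of "z + h *\<^sub>R e"] h by (intro divide_right_mono mult_left_mono) (auto simp: v1_def)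
      then have r1: "v1 * c \<le> v1 * (a z - a (z + h *\<^sub>R e)) / h" using h by simp
      have "c * s / 2 \<le> v1 * c" using mult_left_mono[OF vs(1)[OF z1], of c] c by (simp add: v1_def mult.commute)
      then have r2: "c * s / 2 \<le> v1 * (a z - a (z + h *\<^sub>R e)) / h" using r1 by linarith
      have v1v: "0 \<le> v1 * v z" "v1 * v z \<le> 5/4 * \<alpha>"
      proof -
        show "0 \<le> v1 * v z" using pos by (simp add: v1_def less_imp_le)
        have "0 \<le> (v1 - v z)\<^sup>2" by simp
        then show "v1 * v z \<le> 5/4 * \<alpha>" using vnear(2)[OF z1] vnear(2)[OF z2]
          unfolding v1_def by (simp add: power2_eq_square algebra_simps)
      qed
      have a2: "\<bar>a z - \<alpha>\<bar> \<le> 2 * (\<alpha> / 16)" by (rule anear) (use z2 in auto)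
      have q: "0 \<le> q" "q \<le> 4 * \<alpha>"
        using vnear[OF z1] vnear[OF z2] v1v a2 \<alpha> unfolding q_def v1_def by linarith+
      have "- b / s \<le> B z" using R \<alpha> by (simp add: B_def)
      then have "- b / s * q \<le> quot h z * q" using less q(1) by (intro mult_right_mono) auto
      moreover have "b / s * q \<le> b / s * (4 * \<alpha>)" using q b s by (intro mult_left_mono) auto
      moreover have "b / s * (4 * \<alpha>) = c * s / 4" using s by (simp add: b_def field_simps flip: ss)
      ultimately have "- (c * s / 4) \<le> quot h z * q" by simp
      \<comment> \<open>With \<open>b = c / 16\<close> the zeroth order term costs at most half of
        the source \<open>c * s / 2\<close>. The other half would have to be balanced by the
        Laplacian of the barrier, which the last part of \<open>big\<close> makes too small.\<close>
      with le r2 have "c * s / 4 \<le> 44 * \<alpha> / R\<^sup>2" by linarith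
      also have "44 * \<alpha> / R\<^sup>2 = 11264 * C\<^sup>2 / \<alpha>" using \<alpha> C by (simp add: R_def field_simps power2_eq_square)
      finally have "c * s * \<alpha> \<le> 45056 * C\<^sup>2" using \<alpha> by (simp add: field_simps)
      moreover have "45056 * C\<^sup>2 < c * (\<alpha> * s)" using big(3) c by (simp add: s_def field_simps)
      ultimately show False by (simp add: mult.commute mult.left_commute)
    qed
    then have "quot h y - B y \<le> 0" using zmax[of y] R by simp
    then show ?thesis by (simp add: B_def)
  qed
  have "\<forall>\<^sub>F h in at_right 0. h < R / 2 \<and> 0 < (h::real)"
    using R by (auto simp: eventually_at_right_field intro!: exI[of _ "R / 2"])
  then have "\<forall>\<^sub>F h in at_right 0. quot h y \<le> - b / s"
    by eventually_elim (use cmp in auto)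
  then show ?thesis using derivative_le_of_quot unfolding b_def s_def by blast
qed

end

section \<open>Lower bounds for \<open>v\<close> on strips\<close>

text \<open>Going back from \<open>y\<close> by \<open>H\<close> against \<open>e\<close> leads to a
  point \<open>p\<close> where \<open>a\<close> is so large that \<open>v \<ge> 1\<close> on the
  unit disc about \<open>p\<close>. A Gaussian barrier on an annulus about \<open>p\<close> carries
  positivity back to \<open>y\<close>. Stated outside the locale, so that \<open>m\<close> and
  \<open>r\<close> are chosen before \<open>v\<close> and \<open>a\<close>.\<close>

lemma front_lower_bound:
  assumes K: "K \<ge> 0" and T: "T \<ge> 0" and cC: "c > 0" "C > 0"
  shows "\<exists>m>0. \<exists>r>0. \<forall>v a g e \<rho> y. front v a g e \<rho> c C \<longrightarrow> - K \<le> a y \<longrightarrow> a y \<le> T \<longrightarrow> norm y + r \<le> \<rho> \<longrightarrow> m \<le> v y"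
proof -
  \<comment> \<open>This gives \<open>a \<ge> 9\<close> on the disc of radius 2 about
    \<open>p\<close>, and \<open>lower_bound\<close> with radius 1 loses 8.\<close>
  define T1 where "T1 = 2 * C + 9"
  define H where "H = (K + T1) / c"
  have H: "H > 0" using K cC by (simp add: H_def T1_def add_nonneg_pos)
  define Q where "Q = T + K + 2 * (C * (2 * H + 3)) + 8"
  have Q: "Q > 0" using K T cC H by (simp add: Q_def add_nonneg_pos)
  \<comment> \<open>\<open>Q\<close> will bound \<open>(v x)\<^sup>2 - a x\<close> on the disc of
    radius \<open>RR\<close> about \<open>p\<close>. With this \<open>\<beta>\<close> the Gaussian
    has Laplacian greater than \<open>Q\<close> times itself at distance at least 1 from
    \<open>p\<close>.\<close>
  define \<beta> where "\<beta> = Q + 2"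
  have \<beta>: "\<beta> > 0" "Q < 4 * \<beta>\<^sup>2 - 4 * \<beta>" 
  proof -
    show "\<beta> > 0" using Q by (simp add: \<beta>_def)
    have "4 * \<beta>\<^sup>2 - 4 * \<beta> = 4 * (Q * Q) + 12 * Q + 8" by (simp add: \<beta>_def power2_eq_square algebra_simps)
    then show "Q < 4 * \<beta>\<^sup>2 - 4 * \<beta>" using Q mult_pos_pos[OF Q Q] by linarith
  qed
  define RR where "RR = H + 1"
  define m where "m = exp (- \<beta> * H\<^sup>2) - exp (- \<beta> * RR\<^sup>2)"
  have "H\<^sup>2 < RR\<^sup>2" using H by (simp add: RR_def power2_eq_square algebra_simps)
  then have m: "m > 0" using \<beta> by (simp add: m_def)
  show ?thesis
  proof (rule exI[of _ m], intro conjI m, rule exI[of _ "2 * H + 4"], intro conjI allI impI)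
    show "2 * H + 4 > 0" using H by simp
    fix v a g e \<rho> y assume "front v a g e \<rho> c C" and aK: "- K \<le> a y" and aT: "a y \<le> T" and y: "norm y + (2 * H + 4) \<le> \<rho>"
    interpret front v a g e \<rho> c C by fact
    define p where "p = y - H *\<^sub>R e"
    have yp: "dist y p = H" using e H by (simp add: p_def dist_norm)
    have inb: "x \<in> ball 0 \<rho>" if "dist y x < 2 * H + 4" for x
      using that y norm_triangle_sub[of x y] by (simp add: dist_norm norm_minus_commute)
    have "a (p + H *\<^sub>R e) \<le> a p - c * H"
      by (rule decr) (use H yp inb[of p] inb[of y] in \<open>auto simp: p_def\<close>)
    then have ap: "a p \<ge> T1" using aK cC by (simp add: p_def H_def)
    have v1: "v x \<ge> 1" if x: "dist p x \<le> 1" for x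
    proof -
      have az: "9 \<le> a z" if "dist x z < 1" for z
      proof -
        have pz: "dist p z < 2" using that x dist_triangle[of p z x] by simp
        then have "dist y z < 2 * H + 4" using yp H dist_triangle[of y z p] by simp
        moreover have "dist y p < 2 * H + 4" using yp H by simp
        ultimately have "\<bar>a p - a z\<bar> \<le> C * dist p z" using inb by (intro lip)
        also have "\<dots> \<le> C * 2" using pz cC by (intro mult_left_mono) auto
        finally show ?thesis using ap by (simp add: T1_def)
      qed
      have "9 - 8 / 1\<^sup>2 \<le> (v x)\<^sup>2" by (rule lower_bound) (use az in auto)
      then have "1\<^sup>2 \<le> (v x)\<^sup>2" by simp
      then show ?thesis by (rule power2_le_imp_le) (use pos[of x] in simp)
    qed
    have coef: "(v x)\<^sup>2 - a x \<le> Q" if x: "dist p x \<le> RR" for x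
    proof -
      have yx: "dist y x \<le> 2 * H + 1" using x yp dist_triangle[of y x p] by (simp add: RR_def)
      have dif: "\<bar>a y - a z\<bar> \<le> C * (2 * H + 3)" if "dist y z < 2 * H + 3" for z
        using that y H by (intro lip_ball) auto
      have "(v x)\<^sup>2 \<le> (T + C * (2 * H + 3)) + 8 / 1\<^sup>2"
      proof (rule upper_bound)
        fix z assume "dist x z < 1"
        then have "dist y z < 2 * H + 3" using yx dist_triangle[of y z x] by simp
        then show "a z \<le> T + C * (2 * H + 3)" using dif[of z] aT by (simp add: abs_le_iff)
      qed (use T cC H in auto)
      moreover have "- a x \<le> K + C * (2 * H + 3)" using dif[of x] yx aK by (simp add: abs_le_iff)
      ultimately show ?thesis by (simp add: Q_def)
    qed
    define \<phi> where "\<phi> = (\<lambda>x. exp (- \<beta> * ((x - p) \<bullet> (x - p))) - exp (- \<beta> * RR\<^sup>2))"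
    have j\<phi>: "\<exists>P. has_jet \<phi> x P (exp (- \<beta> * ((x - p) \<bullet> (x - p))) * (4 * \<beta>\<^sup>2 * ((x - p) \<bullet> (x - p)) - 4 * \<beta>))" for x
    proof -
      have "has_jet (\<lambda>x. exp (- \<beta> * ((x - p) \<bullet> (x - p))) - exp (- \<beta> * RR\<^sup>2)) x
       (exp (- \<beta> * ((x - p) \<bullet> (x - p))) *\<^sub>R ((- \<beta>) *\<^sub>R (2 *\<^sub>R (x - p))) - 0)
       (exp (- \<beta> * ((x - p) \<bullet> (x - p))) * ((- \<beta>) * 4 + ((- \<beta>) *\<^sub>R (2 *\<^sub>R (x - p))) \<bullet> ((- \<beta>) *\<^sub>R (2 *\<^sub>R (x - p)))) - 0)"
        by (intro has_jet_diff has_jet_exp has_jet_cmult has_jet_dist_sq has_jet_const)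
      then have ex: "\<exists>P. has_jet \<phi> x P (exp (- \<beta> * ((x - p) \<bullet> (x - p))) * ((- \<beta>) * 4 + ((- \<beta>) *\<^sub>R (2 *\<^sub>R (x - p))) \<bullet> ((- \<beta>) *\<^sub>R (2 *\<^sub>R (x - p)))) - 0)"
        unfolding \<phi>_def by (rule exI)
      have eq: "exp (- \<beta> * ((x - p) \<bullet> (x - p))) * ((- \<beta>) * 4 + ((- \<beta>) *\<^sub>R (2 *\<^sub>R (x - p))) \<bullet> ((- \<beta>) *\<^sub>R (2 *\<^sub>R (x - p)))) - 0
         = exp (- \<beta> * ((x - p) \<bullet> (x - p))) * (4 * \<beta>\<^sup>2 * ((x - p) \<bullet> (x - p)) - 4 * \<beta>)"
        unfolding inner_scaleR_left inner_scaleR_right by (simp add: power2_eq_square algebra_simps)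
      show ?thesis using ex unfolding eq .
    qed
    have jd: "\<exists>P. has_jet (\<lambda>x. \<phi> x - v x) x P
        (exp (- \<beta> * ((x - p) \<bullet> (x - p))) * (4 * \<beta>\<^sup>2 * ((x - p) \<bullet> (x - p)) - 4 * \<beta>) - v x * ((v x)\<^sup>2 - a x))" for x
      using j\<phi>[of x] has_jet_diff[OF _ jet[of x]] by blast
    have "continuous_on (cball p RR) (\<lambda>x. \<phi> x - v x)"
      using jd by (auto intro!: continuous_at_imp_continuous_on intro: has_jet_isCont)
    from continuous_attains_sup[OF compact_cball _ this]
    obtain z where z: "z \<in> cball p RR" and zmax: "\<And>x. x \<in> cball p RR \<Longrightarrow> \<phi> x - v x \<le> \<phi> z - v z"
      using H by (auto simp: RR_def)
    have dsq: "(x - p) \<bullet> (x - p) = (dist p x)\<^sup>2" for x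
      by (simp add: dist_norm norm_minus_commute flip: power2_norm_eq_inner)
    have "\<phi> z \<le> v z"
    proof (rule ccontr)
      assume "\<not> \<phi> z \<le> v z"
      then have less: "v z < \<phi> z" by simp
      \<comment> \<open>The contact point lies in the open annulus: on the unit disc
        \<open>\<phi> < 1 \<le> v\<close>, and on the outer circle \<open>\<phi>\<close>
        vanishes.\<close>
      have "exp (- \<beta> * ((z - p) \<bullet> (z - p))) \<le> 1" using \<beta> by simp
      then have "\<phi> z < 1" unfolding \<phi>_def using exp_gt_zero[of "- \<beta> * RR\<^sup>2"] by linarith
      then have "dist p z > 1" using v1[of z] less by force
      moreover have "dist p z \<noteq> RR"
        using less pos[of z] by (auto simp: \<phi>_def dsq)
      ultimately have zz: "1 < dist p z" "dist p z < RR" using z by auto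
      have "\<forall>\<^sub>F x in nhds z. x \<in> ball p RR" using zz by (intro eventually_nhds_in_open) auto
      then have ev: "\<forall>\<^sub>F x in nhds z. \<phi> x - v x \<le> \<phi> z - v z" by eventually_elim (use zmax in auto)
      obtain P where P: "has_jet (\<lambda>x. \<phi> x - v x) z P
        (exp (- \<beta> * ((z - p) \<bullet> (z - p))) * (4 * \<beta>\<^sup>2 * ((z - p) \<bullet> (z - p)) - 4 * \<beta>) - v z * ((v z)\<^sup>2 - a z))"
        using jd by blast
      define E where "E = exp (- \<beta> * ((z - p) \<bullet> (z - p)))"
      have "E > 0" by (simp add: E_def)
      have "E * (4 * \<beta>\<^sup>2 * ((z - p) \<bullet> (z - p)) - 4 * \<beta>) \<le> v z * ((v z)\<^sup>2 - a z)"
        using has_jet_local_max(2)[OF P ev] by (simp add: E_def)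
      also have "\<dots> \<le> v z * Q" using coef[of z] zz pos[of z] by (intro mult_left_mono) auto
      also have "\<dots> \<le> E * Q" 
      proof (rule mult_right_mono)
        show "v z \<le> E" using less unfolding \<phi>_def E_def using exp_gt_zero[of "- \<beta> * RR\<^sup>2"] by linarith
      qed (use Q in simp)
      finally have "4 * \<beta>\<^sup>2 * ((z - p) \<bullet> (z - p)) - 4 * \<beta> \<le> Q" using \<open>E > 0\<close> by simp
      moreover have "4 * \<beta>\<^sup>2 * 1 \<le> 4 * \<beta>\<^sup>2 * ((z - p) \<bullet> (z - p))"
        unfolding dsq using zz by (intro mult_left_mono) (auto simp: one_le_power)
      ultimately show False using \<beta> by simp
    qed
    then have "\<phi> y \<le> v y" using zmax[of y] yp by (simp add: dist_commute RR_def)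
    then show "m \<le> v y" by (simp add: \<phi>_def dsq m_def yp dist_commute[of p y])
  qed
qed

section \<open>Comparison on a long curved box\<close>

context front
begin

text \<open>The barrier is compared with the difference quotient after division by \<open>v\<close>: the linearized
  operator need not have a positive zeroth order coefficient here, but \<open>v\<close> is a supersolution of it.\<close>

lemma box_comparison:
  fixes f :: "real^2"
  assumes f: "norm f = 1" and fe: "f \<bullet> e = 0" and a0: "a 0 = 0"
    and h: "0 < h" "h \<le> 1" and K: "K > 0" and T: "T > 0" and N: "N \<ge> 1"
    and \<rho>: "N + (C * N + K + T) / c + 4 \<le> \<rho>"
    and b: "b > 0" and A: "A \<ge> 0" and \<delta>: "\<delta> > 0"
    and vV: "\<And>x. norm x + 2 \<le> \<rho> \<Longrightarrow> - K - C \<le> a x \<Longrightarrow> a x \<le> T \<Longrightarrow> m \<le> v x \<and> v x \<le> V \<and> norm (g x) \<le> \<Gamma>"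
    and m: "m > 0"
    and m0: "\<And>x. norm x + 2 \<le> \<rho> \<Longrightarrow> - C \<le> a x \<Longrightarrow> a x \<le> T \<Longrightarrow> m0 \<le> v x"
    and bV: "8 * V\<^sup>2 * b \<le> c" and \<delta>m: "8 * \<delta> * T \<le> c * m0" and AN: "A * (4 * \<Gamma> + 2 * V) / N \<le> c * m / 4"
    and left: "\<And>x. norm x + 2 \<le> \<rho> \<Longrightarrow> a x = T \<Longrightarrow> quot h x \<le> - b * v x"
    and right: "\<And>x. norm x + 2 \<le> \<rho> \<Longrightarrow> a x = - K \<Longrightarrow> quot h x \<le> - b * v x + \<delta>"
    and lateral: "\<And>x. norm x + 2 \<le> \<rho> \<Longrightarrow> - K \<le> a x \<Longrightarrow> a x \<le> T \<Longrightarrow> quot h x \<le> (A - b) * v x"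
    and y: "norm y \<le> N + (C * N + K + T) / c + 1" "\<bar>y \<bullet> f\<bar> \<le> N" "- K \<le> a y" "a y \<le> T"
  shows "quot h y \<le> - b * v y + \<delta> + A / N\<^sup>2 * (v y * ((y \<bullet> f) * (y \<bullet> f)))"
proof -
  define r where "r = N + (C * N + K + T) / c + 1"
  have r\<rho>: "r + 3 \<le> \<rho>" using \<rho> by (simp add: r_def)
  define \<Omega> where "\<Omega> = {x. norm x \<le> r \<and> \<bar>x \<bullet> f\<bar> \<le> N \<and> - K \<le> a x \<and> a x \<le> T}"
  have ff: "f \<bullet> f = 1" using f by (simp add: norm_eq_1)
  have in_ball: "x \<in> ball 0 \<rho>" if "norm x \<le> r + 1" for x using that r\<rho> by simp
  have acont: "continuous_on (cball 0 r) a"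
  proof (rule continuous_onI)
    fix \<epsilon> :: real and x :: "real^2"
    assume x: "x \<in> cball 0 r" and eps: "\<epsilon> > 0"
    show "\<exists>d>0. \<forall>x'\<in>cball 0 r. dist x' x < d \<longrightarrow> dist (a x') (a x) \<le> \<epsilon>"
    proof (intro exI[of _ "\<epsilon> / C"] conjI ballI impI)
      show "\<epsilon> / C > 0" using eps C by simp
      fix x' :: "real^2" assume x': "x' \<in> cball 0 r" "dist x' x < \<epsilon> / C"
      have "\<bar>a x' - a x\<bar> \<le> C * dist x' x" using x x' in_ball[of x] in_ball[of x'] by (intro lip) auto
      also have "\<dots> \<le> \<epsilon>" using x' C by (simp add: field_simps)
      finally show "dist (a x') (a x) \<le> \<epsilon>" by (simp add: dist_real_def)
    qed
  qed
  \<comment> \<open>Keeps the maximum off the circle of radius \<open>r\<close>. At the foot point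
    \<open>t *\<^sub>R f\<close> the size of \<open>a\<close> is at most \<open>C * N\<close>; as
    \<open>a\<close> falls at rate \<open>c\<close> along \<open>e\<close> and stays between
    \<open>- K\<close> and \<open>T\<close>, the normal coordinate \<open>s\<close> is at most
    \<open>(C * N + K + T) / c\<close> in size.\<close>
  have not_r: "norm x < r" if x: "x \<in> \<Omega>" for x
  proof -
    define s t where "s = x \<bullet> e" and "t = x \<bullet> f"
    define u where "u = x - s *\<^sub>R e - t *\<^sub>R f"
    have ue: "u \<bullet> e = 0" "u \<bullet> f = 0"
      using ee ff fe inner_commute[of e f] by (simp_all add: u_def s_def t_def inner_diff_left)
    have "u = 0"
    proof -
      have "pairwise orthogonal {e, f}" using fe by (auto simp: pairwise_def orthogonal_def inner_commute)
      moreover have "0 \<notin> {e, f}" using e f by auto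
      ultimately have "independent {e, f}" by (rule pairwise_orthogonal_independent)
      moreover have "e \<noteq> f" using fe ee by auto
      ultimately have "UNIV \<subseteq> span {e, f}" by (intro card_ge_dim_independent) auto
      then have "orthogonal u w" for w
        by (intro orthogonal_to_span[of w "{e, f}"]) (use ue in \<open>auto simp: orthogonal_def\<close>)
      then show ?thesis using orthogonal_self by blast
    qed
    then have x_eq: "x = s *\<^sub>R e + t *\<^sub>R f" by (simp add: u_def algebra_simps)
    have tN: "\<bar>t\<bar> \<le> N" using x by (simp add: \<Omega>_def t_def)
    have tf: "norm (t *\<^sub>R f) \<le> N" using tN f by simp
    have rN: "N \<le> r" using K T N c C by (simp add: r_def)
    then have tb: "t *\<^sub>R f \<in> ball 0 \<rho>" using tf by (intro in_ball) simp
    have xb: "x \<in> ball 0 \<rho>" using x by (intro in_ball) (simp add: \<Omega>_def)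
    have "\<bar>a (t *\<^sub>R f) - a 0\<bar> \<le> C * dist (t *\<^sub>R f) 0" using tb r\<rho> rN N by (intro lip) auto
    also have "\<dots> \<le> C * N" using tf C by (intro mult_left_mono) auto
    finally have at: "\<bar>a (t *\<^sub>R f)\<bar> \<le> C * N" using a0 by simp
    have xa: "- K \<le> a x" "a x \<le> T" using x by (auto simp: \<Omega>_def)
    have "c * \<bar>s\<bar> \<le> C * N + K + T"
    proof (cases "s \<ge> 0")
      case True
      then have "a x \<le> a (t *\<^sub>R f) - c * s"
        using decr[of "t *\<^sub>R f" s] tb xb by (simp add: x_eq add.commute)
      then show ?thesis using True xa at T by (simp add: abs_le_iff)
    next
      case False
      have tx: "x + (- s) *\<^sub>R e = t *\<^sub>R f" by (simp add: x_eq)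
      have "a (x + (- s) *\<^sub>R e) \<le> a x - c * (- s)"
        using decr[OF xb, of "- s"] tb False unfolding tx by simp
      then show ?thesis using False xa at K unfolding tx by (simp add: abs_le_iff)
    qed
    then have "\<bar>s\<bar> \<le> (C * N + K + T) / c" using c by (simp add: field_simps)
    moreover have "norm x \<le> norm (s *\<^sub>R e) + norm (t *\<^sub>R f)" unfolding x_eq by (rule norm_triangle_ineq)
    ultimately show ?thesis using e tf by (simp add: r_def)
  qed
  have "compact \<Omega>"
  proof -
    have cl: "closed {x \<in> cball 0 r. a x \<in> {- K..T}}"
      using continuous_closed_preimage[OF acont closed_cball, of "{- K..T}"] by (simp add: vimage_def Int_def)
    have "closed {x. \<bar>x \<bullet> f\<bar> \<le> N}" by (intro closed_Collect_le continuous_intros)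
    from closed_Int[OF cl this] have "closed \<Omega>" by (simp add: \<Omega>_def Int_def conj_ac)
    moreover have "bounded \<Omega>" by (rule boundedI[of _ r]) (simp add: \<Omega>_def)
    ultimately show ?thesis by (simp add: compact_eq_bounded_closed)
  qed
  have y\<Omega>: "y \<in> \<Omega>" using y by (simp add: \<Omega>_def r_def)
  \<comment> \<open>With this normalization the tangential term of \<open>B\<close> equals
    \<open>A * v\<close> on the lateral sides.\<close>
  define k where "k = A / N\<^sup>2"
  have k: "k \<ge> 0" using A by (simp add: k_def)
  define B where "B = (\<lambda>x. (- b) * v x + \<delta> + k * (v x * ((x \<bullet> f) * (x \<bullet> f))))"
  have jB: "\<exists>P. has_jet B x P ((- b) * (v x * ((v x)\<^sup>2 - a x)) + k * (2 * v x + 4 * (x \<bullet> f) * (g x \<bullet> f) + (x \<bullet> f)\<^sup>2 * (v x * ((v x)\<^sup>2 - a x))))" for x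
  proof -
    note J = has_jet_add[OF has_jet_add[OF has_jet_cmult[OF jet[of x], of "- b"] has_jet_const[of \<delta> x]]
      has_jet_cmult[OF has_jet_mult[OF jet[of x] has_jet_mult[OF has_jet_inner[of f x] has_jet_inner[of f x]]], of k]]
    have ex: "\<exists>P. has_jet B x P
       ((- b) * (v x * ((v x)\<^sup>2 - a x)) + 0 + k * (v x * ((x \<bullet> f) * 0 + 2 * (f \<bullet> f) + (x \<bullet> f) * 0)
          + 2 * (g x \<bullet> ((x \<bullet> f) *\<^sub>R f + (x \<bullet> f) *\<^sub>R f)) + ((x \<bullet> f) * (x \<bullet> f)) * (v x * ((v x)\<^sup>2 - a x))))"
      unfolding B_def by (rule exI, rule J)
    have eq: "(- b) * (v x * ((v x)\<^sup>2 - a x)) + 0 + k * (v x * ((x \<bullet> f) * 0 + 2 * (f \<bullet> f) + (x \<bullet> f) * 0)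
          + 2 * (g x \<bullet> ((x \<bullet> f) *\<^sub>R f + (x \<bullet> f) *\<^sub>R f)) + ((x \<bullet> f) * (x \<bullet> f)) * (v x * ((v x)\<^sup>2 - a x)))
       = (- b) * (v x * ((v x)\<^sup>2 - a x)) + k * (2 * v x + 4 * (x \<bullet> f) * (g x \<bullet> f) + (x \<bullet> f)\<^sup>2 * (v x * ((v x)\<^sup>2 - a x)))"
      unfolding inner_add_right inner_scaleR_right using ff by (simp add: power2_eq_square)
    show ?thesis using ex unfolding eq .
  qed
  have jq: "\<exists>P. has_jet (quot h) x P (quot h x * ((v (x + h *\<^sub>R e))\<^sup>2 + v (x + h *\<^sub>R e) * v x + (v x)\<^sup>2 - a x) + v (x + h *\<^sub>R e) * (a x - a (x + h *\<^sub>R e)) / h)" for x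
    using jet_quot[of h x] h by blast
  have "continuous_on \<Omega> (\<lambda>x. (quot h x - B x) / v x)"
  proof -
    have "isCont (\<lambda>x. (quot h x - B x) / v x) x" for x
      using jq[of x] jB[of x] pos[of x] has_jet_isCont[OF jet[of x]]
      by (auto intro!: continuous_intros dest!: has_jet_isCont)
    then show ?thesis by (simp add: continuous_at_imp_continuous_on)
  qed
  from continuous_attains_sup[OF \<open>compact \<Omega>\<close> _ this]
  obtain z where z: "z \<in> \<Omega>" and zmax: "\<And>x. x \<in> \<Omega> \<Longrightarrow> (quot h x - B x) / v x \<le> (quot h z - B z) / v z"
    using y\<Omega> by auto
  define \<tau> where "\<tau> = (quot h z - B z) / v z"
  have "\<tau> \<le> 0"
  proof (rule ccontr)
    assume "\<not> \<tau> \<le> 0"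
    then have \<tau>: "\<tau> > 0" by simp
    have qz: "quot h z = B z + \<tau> * v z" using pos[of z] by (simp add: \<tau>_def)
    then have less: "B z < quot h z" using \<tau> pos[of z] by simp
    have zr: "norm z + 3 \<le> \<rho>" using z r\<rho> not_r[OF z] \<rho> unfolding r_def by linarith
    have z2: "norm z + 2 \<le> \<rho>" using zr by simp
    have za: "- K \<le> a z" "a z \<le> T" "\<bar>z \<bullet> f\<bar> \<le> N" using z by (auto simp: \<Omega>_def)
    have last: "0 \<le> k * (v z * ((z \<bullet> f) * (z \<bullet> f)))" using k pos[of z] by simp
    have "a z \<noteq> T" using left[OF z2] less last \<delta> by (auto simp: B_def)
    moreover have "a z \<noteq> - K" using right[OF z2] less last by (auto simp: B_def)
    moreover have "\<bar>z \<bullet> f\<bar> \<noteq> N"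
    proof
      assume "\<bar>z \<bullet> f\<bar> = N"
      then have "(z \<bullet> f) * (z \<bullet> f) = N\<^sup>2" by (metis abs_mult_self_eq power2_eq_square)
      then have "B z = (A - b) * v z + \<delta>" using N by (simp add: B_def k_def algebra_simps)
      then show False using lateral[OF z2 za(1,2)] less \<delta> by simp
    qed
    ultimately have strict: "- K < a z" "a z < T" "\<bar>z \<bullet> f\<bar> < N" using za by auto
    have "isCont a z"
      using continuous_on_interior[OF acont, of z] not_r[OF z] by (simp add: interior_cball)
    then have at: "(a \<longlongrightarrow> a z) (nhds z)" by (simp add: tendsto_nhds_iff isCont_def)
    have "\<forall>\<^sub>F x in nhds z. x \<in> ball 0 r \<inter> {x. \<bar>x \<bullet> f\<bar> < N}"
      using not_r[OF z] strict
      by (intro eventually_nhds_in_open open_Int open_ball open_Collect_less continuous_intros) auto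
    then have "\<forall>\<^sub>F x in nhds z. x \<in> \<Omega>"
      using order_tendstoD(1)[OF at strict(1)] order_tendstoD(2)[OF at strict(2)]
      by eventually_elim (auto simp: \<Omega>_def)
    then have ev: "\<forall>\<^sub>F x in nhds z. quot h x - B x - \<tau> * v x \<le> quot h z - B z - \<tau> * v z"
    proof eventually_elim
      case (elim x)
      have "quot h x - B x \<le> \<tau> * v x" using zmax[OF elim] pos[of x] by (simp add: \<tau>_def[symmetric] field_simps)
      then show ?case using qz by simp
    qed
    define v1 v0 s where "v1 = v (z + h *\<^sub>R e)" and "v0 = v z" and "s = (v z)\<^sup>2 - a z"
    obtain P where P: "has_jet (quot h) z P (quot h z * (v1\<^sup>2 + v1 * v0 + v0\<^sup>2 - a z) + v1 * (a z - a (z + h *\<^sub>R e)) / h)"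
      using jq unfolding v1_def v0_def by blast
    obtain P' where P': "has_jet B z P' ((- b) * (v0 * s) + k * (2 * v0 + 4 * (z \<bullet> f) * (g z \<bullet> f) + (z \<bullet> f)\<^sup>2 * (v0 * s)))"
      using jB unfolding v0_def s_def by blast
    have P'': "has_jet (\<lambda>x. \<tau> * v x) z (\<tau> *\<^sub>R g z) (\<tau> * (v0 * s))"
      unfolding v0_def s_def by (intro has_jet_cmult jet)
    from has_jet_local_max(2)[OF has_jet_diff[OF has_jet_diff[OF P P'] P''] ev]
    have main: "quot h z * (v1\<^sup>2 + v1 * v0 + v0\<^sup>2 - a z) + v1 * (a z - a (z + h *\<^sub>R e)) / h
       - ((- b) * (v0 * s) + k * (2 * v0 + 4 * (z \<bullet> f) * (g z \<bullet> f) + (z \<bullet> f)\<^sup>2 * (v0 * s))) - \<tau> * (v0 * s) \<le> 0" .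
    have pv: "v0 > 0" "v1 > 0" using pos by (auto simp: v0_def v1_def)
    have z1: "norm (z + h *\<^sub>R e) + 2 \<le> \<rho>" using norm_triangle_ineq[of z "h *\<^sub>R e"] e h zr by simp
    have zb: "z \<in> ball 0 \<rho>" "z + h *\<^sub>R e \<in> ball 0 \<rho>" using zr z1 by auto
    have adec: "a (z + h *\<^sub>R e) \<le> a z - c * h" using decr[OF zb] h by simp
    have a1: "a z - C \<le> a (z + h *\<^sub>R e)" "a (z + h *\<^sub>R e) \<le> T"
    proof -
      have "\<bar>a z - a (z + h *\<^sub>R e)\<bar> \<le> C * dist z (z + h *\<^sub>R e)" by (rule lip[OF zb])
      also have "\<dots> \<le> C * 1" using e h C by (intro mult_left_mono) (auto simp: dist_norm)
      finally show "a z - C \<le> a (z + h *\<^sub>R e)" by simp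
      show "a (z + h *\<^sub>R e) \<le> T" using adec za mult_pos_pos[OF c h(1)] by simp
    qed
    have n0: "m \<le> v0 \<and> v0 \<le> V \<and> norm (g z) \<le> \<Gamma>" unfolding v0_def using vV[OF z2] za C by simp
    have n1: "m \<le> v1 \<and> v1 \<le> V" unfolding v1_def using vV[OF z1] za a1 by simp
    have V: "V > 0" using n0 m by simp
    have "c * h * v1 \<le> v1 * (a z - a (z + h *\<^sub>R e))"
      using adec pv by (simp add: mult.commute[of _ v1])
    then have e1: "c * v1 \<le> v1 * (a z - a (z + h *\<^sub>R e)) / h" using h by (simp add: field_simps)
    have e2: "quot h z * (v1\<^sup>2 + v1 * v0 + v0\<^sup>2 - a z) = quot h z * s + quot h z * (v1\<^sup>2 + v1 * v0)"
      by (simp add: s_def v0_def algebra_simps)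
    have e3: "quot h z * s = - b * (v0 * s) + \<delta> * s + k * ((z \<bullet> f)\<^sup>2 * (v0 * s)) + \<tau> * (v0 * s)"
      unfolding qz B_def by (simp add: v0_def algebra_simps power2_eq_square)
    \<comment> \<open>Since \<open>v\<close> solves the linear equation with coefficient
      \<open>s\<close>, all terms containing \<open>v0 * s\<close> cancel, including those with
      \<open>\<tau>\<close>. The source \<open>c * v1\<close> is left against three errors;
      \<open>t1\<close>, \<open>t2\<close> and \<open>t3\<close> limit them to 1/8, 1/4 and 1/4 of
      it.\<close>
    from main e1 e2 e3 have main2: "\<delta> * s + quot h z * (v1\<^sup>2 + v1 * v0) + c * v1 \<le> k * (2 * v0 + 4 * (z \<bullet> f) * (g z \<bullet> f))"
      by (simp add: algebra_simps)
    \<comment> \<open>\<open>s\<close> can be negative only where \<open>a z > 0\<close>. There the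
      shifted point is still above level \<open>- C\<close>, so \<open>m0\<close> bounds
      \<open>v1\<close> from below; \<open>m0\<close> involves levels above \<open>- C\<close> only,
      which allows \<open>\<delta>\<close> to be fixed before \<open>K\<close>.\<close>
    have t1: "- (c * v1 / 8) \<le> \<delta> * s"
    proof (cases "a z \<ge> 0")
      case True
      have "m0 \<le> v1" unfolding v1_def using m0[OF z1] a1 True by simp
      then have "8 * \<delta> * T \<le> c * v1" using \<delta>m mult_left_mono[of m0 v1 c] c by linarith
      moreover have "- T \<le> s" using za by (simp add: s_def) (smt (verit) zero_le_power2)
      then have "\<delta> * (- T) \<le> \<delta> * s" using \<delta> by (intro mult_left_mono) auto
      ultimately show ?thesis by simp
    next
      case False
      then have "s \<ge> 0" using zero_le_power2[of "v z"] unfolding s_def by linarith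
      then have "\<delta> * s \<ge> 0" using \<delta> by simp
      moreover have "c * v1 > 0" using c pv by simp
      ultimately show ?thesis by simp
    qed
    \<comment> \<open>Being above the barrier already bounds the quotient from below by
      \<open>- b * v0\<close>; the smallness of \<open>b\<close> in \<open>bV\<close> does the
      rest.\<close>
    have t2: "- (c * v1 / 4) \<le> quot h z * (v1\<^sup>2 + v1 * v0)"
    proof -
      have "- b * v0 \<le> quot h z" using less last \<delta> by (simp add: B_def v0_def)
      then have "- b * v0 * (v1\<^sup>2 + v1 * v0) \<le> quot h z * (v1\<^sup>2 + v1 * v0)"
        using pv by (intro mult_right_mono) auto
      moreover have "b * v0 * (v1\<^sup>2 + v1 * v0) \<le> c * v1 / 4"
      proof -
        have "b * v0 * (v1\<^sup>2 + v1 * v0) = v1 * (b * (v0 * (v1 + v0)))" by (simp add: power2_eq_square algebra_simps)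
        also have "\<dots> \<le> v1 * (b * (V * (V + V)))" using n0 n1 pv b V by (intro mult_left_mono mult_mono) auto
        also have "\<dots> \<le> v1 * (c / 4)" using bV pv by (intro mult_left_mono) (auto simp: power2_eq_square ac_simps)
        finally show ?thesis by (simp add: mult.commute)
      qed
      ultimately show ?thesis by simp
    qed
    \<comment> \<open>Differentiating the tangential weight produces terms of order
      \<open>A / N\<close>, small for a long box.\<close>
    have t3: "k * (2 * v0 + 4 * (z \<bullet> f) * (g z \<bullet> f)) \<le> c * v1 / 4"
    proof -
      have "\<bar>g z \<bullet> f\<bar> \<le> \<Gamma>" using Cauchy_Schwarz_ineq2[of "g z" f] f n0 by simp
      then have "\<bar>(z \<bullet> f) * (g z \<bullet> f)\<bar> \<le> N * \<Gamma>" unfolding abs_mult using za N by (intro mult_mono) auto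
      then have "4 * (z \<bullet> f) * (g z \<bullet> f) \<le> 4 * (N * \<Gamma>)" by linarith
      moreover have "2 * v0 \<le> N * (2 * V)" using n0 N mult_mono[of 1 N "2 * v0" "2 * V"] pv by simp
      ultimately have "2 * v0 + 4 * (z \<bullet> f) * (g z \<bullet> f) \<le> N * (4 * \<Gamma> + 2 * V)" by (simp add: algebra_simps)
      then have "k * (2 * v0 + 4 * (z \<bullet> f) * (g z \<bullet> f)) \<le> k * (N * (4 * \<Gamma> + 2 * V))" using k by (intro mult_left_mono)
      also have "\<dots> = A * (4 * \<Gamma> + 2 * V) / N" using N by (simp add: k_def power2_eq_square)
      also have "\<dots> \<le> c * m / 4" by (rule AN)
      also have "\<dots> \<le> c * v1 / 4" using n1 c by simp
      finally show ?thesis .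
    qed
    have "c * v1 > 0" using c pv by simp
    with main2 t1 t2 t3 show False by linarith
  qed
  then have "(quot h y - B y) / v y \<le> 0" using zmax[OF y\<Omega>] by (simp add: \<tau>_def)
  then have "quot h y \<le> B y" using pos[of y] by (simp add: divide_le_0_iff)
  then show ?thesis by (simp add: B_def k_def)
qed

end

section \<open>Estimates on the sides of the box\<close>

text \<open>Lets the box comparison run in a smaller ball, so that the estimates feeding its
  hypotheses have room in the larger one.\<close>

lemma front_mono:
  assumes "front v a g e \<rho> c C" "\<rho>' \<le> \<rho>"
  shows "front v a g e \<rho>' c C"
proof -
  interpret front v a g e \<rho> c C by fact
  show ?thesis by unfold_locales (use c C e lip decr assms(2) in auto)
qed

context front
begin

lemma shift_norm: "s \<ge> 0 \<Longrightarrow> norm (x + s *\<^sub>R e) \<le> norm x + s"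
  using norm_triangle_ineq[of x "s *\<^sub>R e"] e by simp

lemma shift_bounds:
  assumes "0 \<le> s" "s \<le> 1" "norm x + 1 < \<rho>"
  shows "a x - C \<le> a (x + s *\<^sub>R e)" "a (x + s *\<^sub>R e) \<le> a x"
proof -
  have b: "x \<in> ball 0 \<rho>" "x + s *\<^sub>R e \<in> ball 0 \<rho>" using assms shift_norm[of s x] by auto
  have "\<bar>a x - a (x + s *\<^sub>R e)\<bar> \<le> C * dist x (x + s *\<^sub>R e)" by (rule lip[OF b])
  also have "\<dots> \<le> C * 1" using e assms C by (intro mult_left_mono) (auto simp: dist_norm)
  finally show "a x - C \<le> a (x + s *\<^sub>R e)" by simp
  have "0 \<le> c * s" using c assms by simp
  then show "a (x + s *\<^sub>R e) \<le> a x" using decr[OF b assms(1)] by linarith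
qed

lemma near_bounds:
  assumes "norm x + r \<le> \<rho>" "dist x z < r"
  shows "a x - C * r \<le> a z" "a z \<le> a x + C * r"
  using lip_ball[OF assms] by (auto simp: abs_le_iff)

text \<open>\<open>upper_bound\<close> with radius 1 bounds \<open>v\<^sup>2\<close> by
  \<open>V\<close>, and \<open>V \<ge> 1\<close> makes \<open>V\<close> a bound for \<open>v\<close>
  as well. The level \<open>L\<close> enters through the size of the Laplacian in
  \<open>gradient_bound\<close>.\<close>

lemma bounds_above_level:
  assumes x: "norm x + 3 \<le> \<rho>" and aT: "a x \<le> T" and T: "T > 0"
  defines "V \<equiv> T + 3 * C + 8"
  shows "\<And>z. dist x z \<le> 2 \<Longrightarrow> v z \<le> V"
    and "- L \<le> a x \<Longrightarrow> L > 0 \<Longrightarrow> norm (g x) \<le> 4 * V + V * (V + L + T + 5 * C)"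
proof -
  have V1: "V \<ge> 1" using T C by (simp add: V_def)
  have v2: "v z \<le> V \<and> (v z)\<^sup>2 \<le> V" if z: "dist x z \<le> 2" for z
  proof -
    have "(v z)\<^sup>2 \<le> (T + 3 * C) + 8 / 1\<^sup>2"
    proof (rule upper_bound)
      fix w assume "dist z w < 1"
      then have "dist x w < 3" using z dist_triangle[of x w z] by simp
      then show "a w \<le> T + 3 * C" using near_bounds(2)[OF x] aT by fastforce
    qed (use T C in auto)
    then have 1: "(v z)\<^sup>2 \<le> V" by (simp add: V_def)
    also have "V \<le> V\<^sup>2" using V1 by (simp add: power2_eq_square)
    finally have "(v z)\<^sup>2 \<le> V\<^sup>2" .
    then have "v z \<le> V" by (rule power2_le_imp_le) (use V1 in simp)
    with 1 show ?thesis by simp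
  qed
  then show "\<And>z. dist x z \<le> 2 \<Longrightarrow> v z \<le> V" by blast
  assume L: "- L \<le> a x" "L > 0"
  have "norm (g x) \<le> 4 * V / 1 + 1 * (V * (V + L + T + 5 * C))"
  proof (rule gradient_bound[where u=v and g=g and y=x and l="\<lambda>z. v z * ((v z)\<^sup>2 - a z)"])
    fix z assume "dist x z \<le> 2 * 1"
    then have z: "dist x z \<le> 2" by simp
    then have z3: "dist x z < 3" by simp
    have "\<bar>(v z)\<^sup>2 - a z\<bar> < V + L + T + 5 * C"
      using v2[OF z] near_bounds[OF x z3] L aT T C zero_le_power2[of "v z"] by (intro abs_less_iff[THEN iffD2]) linarith
    then have "v z * \<bar>(v z)\<^sup>2 - a z\<bar> < V * (V + L + T + 5 * C)"
      using v2[OF z] pos[of z] V1 by (intro mult_le_less_imp_less) auto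
    then show "has_jet v z (g z) (v z * ((v z)\<^sup>2 - a z)) \<and> \<bar>v z\<bar> \<le> V \<and> \<bar>v z * ((v z)\<^sup>2 - a z)\<bar> < V * (V + L + T + 5 * C)"
      using jet v2[OF z] pos[of z] by (simp add: abs_mult)
  qed simp
  then show "norm (g x) \<le> 4 * V + V * (V + L + T + 5 * C)" by simp
qed

text \<open>Near \<open>x\<close> the function \<open>a\<close> is nonpositive on discs of radius
  \<open>K / (2 * C)\<close>, so \<open>upper_bound\<close> with \<open>m = 0\<close> gives
  \<open>v\<close> of order \<open>C / K\<close>. The linear coefficient being of order
  \<open>K\<close>, \<open>gradient_bound\<close> is used at scale
  \<open>1 / sqrt K\<close>.\<close>

lemma decay:
  assumes K: "a x = - K" "K \<ge> 6 * C + 1" and x: "norm x + (K / C + 4) \<le> \<rho>" and h: "0 < h" "h \<le> 1"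
  shows "v x \<le> 6 * C / K" "quot h x \<le> 44 * C / sqrt K"
proof -
  have K0: "K > 0" using K C by simp
  define s where "s = sqrt K"
  have s: "s \<ge> 1" "s * s = K" using K C by (auto simp: s_def)
  have x3: "norm x + 3 \<le> \<rho>" using x K0 C by (smt (verit) divide_pos_pos)
  have vz: "v z \<le> 6 * C / K" "\<bar>a z + K\<bar> \<le> 3 * C" if z: "dist x z < 3" for z
  proof -
    show az: "\<bar>a z + K\<bar> \<le> 3 * C" using near_bounds[OF x3 z] K by (simp add: abs_le_iff)
    have "norm z \<le> norm x + dist x z" by (metis dist_commute dist_norm norm_triangle_sub)
    moreover have "K / (2 * C) \<le> K / C" using K0 C by (simp add: field_simps)
    ultimately have zR: "norm z + K / (2 * C) \<le> \<rho>" using x z by linarith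
    have "(v z)\<^sup>2 \<le> 0 + 8 / (K / (2 * C))\<^sup>2"
    proof (rule upper_bound)
      fix w assume "dist z w < K / (2 * C)"
      from near_bounds(2)[OF zR this] have "a w \<le> a z + K / 2" using C by simp
      then show "a w \<le> 0" using az K C by (simp add: abs_le_iff)
    qed (use K0 C in auto)
    also have "\<dots> = 32 * C\<^sup>2 / K\<^sup>2" using K0 C by (simp add: field_simps)
    also have "\<dots> \<le> (6 * C / K)\<^sup>2" by (simp add: power_divide power_mult_distrib divide_right_mono)
    finally show "v z \<le> 6 * C / K" by (rule power2_le_imp_le) (use K0 C in simp)
  qed
  show "v x \<le> 6 * C / K" using vz by simp
  show "quot h x \<le> 44 * C / sqrt K"
  proof (rule quot_le[OF h(1)])
    fix t assume t: "0 < t" "t < h"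
    have "norm (g (x + t *\<^sub>R e)) \<le> 4 * (6 * C / K) / (1 / s) + (1 / s) * (20 * C)"
    proof (rule gradient_bound[where u=v and g=g and l="\<lambda>z. v z * ((v z)\<^sup>2 - a z)"])
      show "1 / s > 0" using s by simp
      fix z assume z: "dist (x + t *\<^sub>R e) z \<le> 2 * (1 / s)"
      have "1 / s \<le> 1" using s by simp
      moreover have "dist x (x + t *\<^sub>R e) < 1" using t h e by (simp add: dist_norm)
      ultimately have z3: "dist x z < 3" using z dist_triangle[of x z "x + t *\<^sub>R e"] by simp
      have "v z \<le> 1" using vz(1)[OF z3] K K0 C by (smt (verit) divide_le_eq_1_pos)
      then have "(v z)\<^sup>2 \<le> 1" using pos[of z] by (simp add: power_le_one)
      then have "\<bar>(v z)\<^sup>2 - a z\<bar> \<le> 1 + K + 3 * C" using vz(2)[OF z3] K0 C zero_le_power2[of "v z"] by linarith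
      then have "v z * \<bar>(v z)\<^sup>2 - a z\<bar> \<le> (6 * C / K) * (1 + K + 3 * C)"
        using vz(1)[OF z3] pos[of z] C K0 by (intro mult_mono) auto
      also have "\<dots> \<le> (6 * C / K) * (3 * K)" using K C K0 by (intro mult_left_mono) auto
      also have "\<dots> < 20 * C" using K0 C by simp
      finally show "has_jet v z (g z) (v z * ((v z)\<^sup>2 - a z)) \<and> \<bar>v z\<bar> \<le> 6 * C / K \<and> \<bar>v z * ((v z)\<^sup>2 - a z)\<bar> < 20 * C"
        using jet vz(1)[OF z3] pos[of z] by (simp add: abs_mult)
    qed
    also have "\<dots> = 44 * C / s" using s(1) by (simp add: field_simps flip: s(2))
    finally have "norm (g (x + t *\<^sub>R e)) \<le> 44 * C / sqrt K" by (simp add: s_def)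
    then show "g (x + t *\<^sub>R e) \<bullet> e \<le> 44 * C / sqrt K"
      using norm_cauchy_schwarz[of "g (x + t *\<^sub>R e)" e] e by simp
  qed
qed

end

section \<open>The derivative bound in the transition strip\<close>

text \<open>The order of the choices avoids circularity: \<open>b\<close> depends on
  \<open>T\<close>, \<open>c\<close> and \<open>C\<close>; \<open>\<delta>\<close> on
  \<open>b\<close>, \<open>m0\<close> and \<open>m1\<close>; then \<open>K\<close> is taken so large
  that the side \<open>a = - K\<close> respects \<open>\<delta>\<close>; then come \<open>m\<close>
  and \<open>\<Gamma>\<close> for the enlarged strip, \<open>A\<close> for the lateral sides, and
  last the length \<open>N\<close>.\<close>

lemma strip_derivative_bound:
  assumes cC: "c > 0" "C > 0" and K0: "K0 > 0" and M: "M > 0" and T: "T = M + C"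
    and big: "\<And>\<alpha>. \<alpha> \<ge> M \<Longrightarrow> 200 * C \<le> \<alpha> * sqrt \<alpha> \<and> c \<le> \<alpha> * sqrt \<alpha> \<and> 45056 * C\<^sup>2 / c < \<alpha> * sqrt \<alpha>"
  shows "\<exists>k>0. \<exists>r. \<forall>v a g e \<rho> t. front v a g e \<rho> c C \<longrightarrow> a 0 = 0 \<longrightarrow> r \<le> \<rho> \<longrightarrow> \<bar>t\<bar> < \<rho> \<longrightarrow>
     - K0 \<le> a (t *\<^sub>R e) \<longrightarrow> a (t *\<^sub>R e) \<le> T \<longrightarrow> g (t *\<^sub>R e) \<bullet> e \<le> - k"
proof -
  have T0: "T > 0" using T M cC by simp
  define V where "V = T + 3 * C + 8"
  have V1: "V \<ge> 1" using T0 cC by (simp add: V_def)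
  \<comment> \<open>The first entry yields the comparison on the side \<open>a = T\<close>, the
    second is the smallness required by \<open>bV\<close>.\<close>
  define b where "b = min (c / 16 / (sqrt T * V)) (c / (8 * V\<^sup>2))"
  have b: "b > 0" using cC T0 V1 by (simp add: b_def)
  have b1: "b * V \<le> c / 16 / sqrt T"
  proof -
    have "b * V \<le> c / 16 / (sqrt T * V) * V" unfolding b_def using V1 by (intro mult_right_mono) auto
    then show ?thesis using V1 by simp
  qed
  have b2: "8 * V\<^sup>2 * b \<le> c"
  proof -
    have "8 * V\<^sup>2 * b \<le> 8 * V\<^sup>2 * (c / (8 * V\<^sup>2))" unfolding b_def by (intro mult_left_mono) auto
    then show ?thesis using V1 by simp
  qed
  obtain m0 r0 where m0: "m0 > 0" "r0 > 0" and
    low0: "\<And>v a g e \<rho> y. front v a g e \<rho> c C \<Longrightarrow> - C \<le> a y \<Longrightarrow> a y \<le> T \<Longrightarrow> norm y + r0 \<le> \<rho> \<Longrightarrow> m0 \<le> v y"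
    using front_lower_bound[of C T c C] cC T0 by (auto 0 4)
  obtain m1 r1 where m1: "m1 > 0" "r1 > 0" and
    low1: "\<And>v a g e \<rho> y. front v a g e \<rho> c C \<Longrightarrow> - K0 \<le> a y \<Longrightarrow> a y \<le> T \<Longrightarrow> norm y + r1 \<le> \<rho> \<Longrightarrow> m1 \<le> v y"
    using front_lower_bound[of K0 T c C] cC T0 K0 by (auto 0 4)
  \<comment> \<open>The first entry leaves half of \<open>b * m1\<close> in the final bound, the
    second is the condition of \<open>box_comparison\<close> on \<open>\<delta>\<close>.\<close>
  define \<delta> where "\<delta> = min (b * m1 / 2) (c * m0 / (8 * T))"
  have \<delta>: "\<delta> > 0" "\<delta> \<le> b * m1 / 2" using b m0 m1 cC T0 by (auto simp: \<delta>_def)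
  have \<delta>m: "8 * \<delta> * T \<le> c * m0"
  proof -
    have "8 * \<delta> * T \<le> 8 * (c * m0 / (8 * T)) * T" unfolding \<delta>_def using T0 by (intro mult_right_mono mult_left_mono) auto
    then show ?thesis using T0 by simp
  qed
  \<comment> \<open>By \<open>decay\<close>, \<open>quot h x + b * v x\<close> on the side
    \<open>a = - K\<close> is at most \<open>S * \<delta> / sqrt K\<close>, hence at most
    \<open>\<delta>\<close> once \<open>K \<ge> S\<^sup>2\<close>.\<close>
  define S where "S = (44 * C + b * (6 * C)) / \<delta>"
  define K where "K = K0 + 6 * C + 1 + S\<^sup>2"
  have K: "K \<ge> K0" "K \<ge> 6 * C + 1" "K > 0" "K \<ge> 1" and KS: "K \<ge> S\<^sup>2"
    using K0 cC zero_le_power2[of S] unfolding K_def by linarith+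
  obtain m r2 where m: "m > 0" "r2 > 0" and
    low2: "\<And>v a g e \<rho> y. front v a g e \<rho> c C \<Longrightarrow> - (K + C) \<le> a y \<Longrightarrow> a y \<le> T \<Longrightarrow> norm y + r2 \<le> \<rho> \<Longrightarrow> m \<le> v y"
    using front_lower_bound[of "K + C" T c C] cC T0 K by (auto 0 4)
  define \<Gamma> where "\<Gamma> = 4 * V + V * (V + (K + C) + T + 5 * C)"
  have \<Gamma>: "\<Gamma> > 0" using V1 K cC T0 by (simp add: \<Gamma>_def add_pos_pos)
  \<comment> \<open>Makes \<open>(A - b) * m = \<Gamma>\<close>, so that the gradient bound alone
    suffices on the lateral sides.\<close>
  define A where "A = \<Gamma> / m + b"
  have A: "A > 0" using \<Gamma> m b by (simp add: A_def add_pos_pos)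
  define N where "N = max 1 (A * (4 * \<Gamma> + 2 * V) / (c * m / 4))"
  have N1: "N \<ge> 1" by (simp add: N_def)
  have AN: "A * (4 * \<Gamma> + 2 * V) / N \<le> c * m / 4"
  proof -
    have "A * (4 * \<Gamma> + 2 * V) / (c * m / 4) \<le> N" by (simp add: N_def)
    then show ?thesis using N1 cC m by (simp add: field_simps)
  qed
  define \<rho>' where "\<rho>' = N + (C * N + K + T) / c + 4"
  define r where "r = \<rho>' + r0 + r1 + r2 + K / C + T / (4 * C) + 5"
  have pieces: "K / C > 0" "T / (4 * C) > 0" using K cC T0 by auto
  show ?thesis
  proof (rule exI[of _ "b * m1 / 2"], intro conjI, goal_cases)
    case 1 then show ?case using b m1 by simp
  next
    case 2
    show ?case
    proof (rule exI[of _ r], intro allI impI)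
      fix v a g e \<rho> t
      assume fr: "front v a g e \<rho> c C" and a0: "a 0 = 0" and r\<rho>: "r \<le> \<rho>" and t\<rho>: "\<bar>t\<bar> < \<rho>"
        and aK: "- K0 \<le> a (t *\<^sub>R e)" and aT: "a (t *\<^sub>R e) \<le> T"
      interpret front v a g e \<rho> c C by fact
      have \<rho>'\<rho>: "\<rho>' \<le> \<rho>" using r\<rho> m0 m1 m pieces by (simp add: r_def)
      interpret small: front v a g e \<rho>' c C by (rule front_mono[OF fr \<rho>'\<rho>])
      define f :: "real^2" where "f = vector [- (e $ 2), e $ 1]"
      have nf: "norm f = 1" using e by (simp add: f_def norm_eq_1 inner_vec_def sum_2)
      have fe: "f \<bullet> e = 0" by (simp add: f_def inner_vec_def sum_2)
      have room: "norm x + 1 + rr \<le> \<rho>" if "norm x + 2 \<le> \<rho>'" "rr \<le> r0 + r1 + r2 + K / C + T / (4 * C) + 6" for x :: "real^2" and rr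
        using that r\<rho> by (simp add: r_def)
      define y where "y = t *\<^sub>R e"
      have tb: "c * \<bar>t\<bar> \<le> K0 + T"
      proof (cases "t \<ge> 0")
        case True
        have "a (0 + t *\<^sub>R e) \<le> a 0 - c * t" by (rule decr) (use True e t\<rho> in auto)
        then show ?thesis using aK a0 True T0 by simp
      next
        case False
        have "a (y + (- t) *\<^sub>R e) \<le> a y - c * (- t)" by (rule decr) (use False e t\<rho> in \<open>auto simp: y_def\<close>)
        then show ?thesis using aT a0 False K0 by (simp add: y_def)
      qed
      have ny: "norm y \<le> (C * N + K + T) / c"
      proof -
        have "0 \<le> C * N" using cC N1 by simp
        then have "c * \<bar>t\<bar> \<le> C * N + K + T" using tb K by linarith
        then show ?thesis using e cC by (simp add: y_def field_simps)
      qed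
      have cmp: "quot h y \<le> - (b * m1 / 2)" if h: "0 < h" "h \<le> 1" for h
      proof -
        have "quot h y \<le> - b * v y + \<delta> + A / N\<^sup>2 * (v y * ((y \<bullet> f) * (y \<bullet> f)))"
        proof (rule small.box_comparison[OF nf fe a0 h K(3) T0 N1 _ b _ \<delta>(1) _ m(1) _ b2 \<delta>m AN])
          show "N + (C * N + K + T) / c + 4 \<le> \<rho>'" by (simp add: \<rho>'_def)
          show "0 \<le> A" using A by simp
        next
          fix x :: "real^2" assume x: "norm x + 2 \<le> \<rho>'" "- K - C \<le> a x" "a x \<le> T"
          have x3: "norm x + 3 \<le> \<rho>" using room[OF x(1), of 2] m0 m1 m pieces by simp
          have "m \<le> v x" by (rule low2[OF fr]) (use x room[OF x(1), of r2] m0 m1 m pieces in auto)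
          moreover have "v x \<le> V" unfolding V_def by (rule bounds_above_level(1)[OF x3 x(3) T0]) simp
          moreover have "norm (g x) \<le> \<Gamma>"
            unfolding \<Gamma>_def V_def by (rule bounds_above_level(2)[OF x3 x(3) T0]) (use x K cC in auto)
          ultimately show "m \<le> v x \<and> v x \<le> V \<and> norm (g x) \<le> \<Gamma>" by simp
        next
          fix x :: "real^2" assume x: "norm x + 2 \<le> \<rho>'" "- C \<le> a x" "a x \<le> T"
          show "m0 \<le> v x" by (rule low0[OF fr]) (use x room[OF x(1), of r0] m0 m1 m pieces in auto)
        next
          fix x :: "real^2" assume x: "norm x + 2 \<le> \<rho>'" "a x = T"
          have x3: "norm x + 3 \<le> \<rho>" using room[OF x(1), of 2] m0 m1 m pieces by simp
          have "quot h x \<le> - (c / 16) / sqrt T"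
          proof (rule quot_le[OF h(1)])
            fix s assume s: "0 < s" "s < h"
            let ?x = "x + s *\<^sub>R e"
            \<comment> \<open>A shift by at most 1 lowers \<open>a\<close> by at most
              \<open>C\<close>. With \<open>T = M + C\<close> the whole segment stays above level
              \<open>M\<close>, where \<open>interior_derivative_bound\<close> applies.\<close>
            have sb: "T - C \<le> a ?x" "a ?x \<le> T" using shift_bounds[of s x] s h x x3 by auto
            have M': "M \<le> a ?x" using sb T by simp
            have "norm ?x + a ?x / (4 * C) \<le> norm x + 1 + T / (4 * C)"
              using shift_norm[of s x] s h sb cC by (intro add_mono divide_right_mono) auto
            also have "\<dots> \<le> \<rho>" using room[OF x(1), of "T / (4 * C)"] m0 m1 m pieces by simp
            finally have "g ?x \<bullet> e \<le> - (c / 16) / sqrt (a ?x)"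
              using big[OF M'] M M' by (intro interior_derivative_bound[OF refl]) auto
            also have "\<dots> \<le> - (c / 16) / sqrt T" using sb M' M cC by (simp add: field_simps)
            finally show "g ?x \<bullet> e \<le> - (c / 16) / sqrt T" .
          qed
          also have "\<dots> \<le> - (b * V)" using b1 by simp
          also have "v x \<le> V" unfolding V_def by (rule bounds_above_level(1)[OF x3 _ T0]) (use x in auto)
          then have "- (b * V) \<le> - b * v x" using b by simp
          finally show "quot h x \<le> - b * v x" .
        next
          fix x :: "real^2" assume x: "norm x + 2 \<le> \<rho>'" "a x = - K"
          have xr: "norm x + (K / C + 4) \<le> \<rho>" using room[OF x(1), of "K / C + 3"] m0 m1 m pieces by simp
          note d = decay[OF x(2) K(2) xr h]
          have sK: "sqrt K > 0" "sqrt K \<le> K" using K by (auto simp: real_sqrt_le_iff intro: real_le_lsqrt simp: power2_eq_square)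
          have "6 * C / K \<le> 6 * C / sqrt K" using sK K cC by (intro divide_left_mono) auto
          then have "b * v x \<le> b * (6 * C / sqrt K)" using d(1) b by (intro mult_left_mono) auto
          then have "quot h x + b * v x \<le> (44 * C + b * (6 * C)) / sqrt K" using d(2) by (simp add: add_divide_distrib)
          also have "\<dots> \<le> \<delta>"
          proof -
            have "S \<le> sqrt K" using KS by (rule real_le_rsqrt)
            then show ?thesis using \<delta> sK by (simp add: S_def field_simps)
          qed
          finally show "quot h x \<le> - b * v x + \<delta>" by simp
        next
          fix x :: "real^2" assume x: "norm x + 2 \<le> \<rho>'" "- K \<le> a x" "a x \<le> T"
          have x3: "norm x + 3 \<le> \<rho>" using room[OF x(1), of 2] m0 m1 m pieces by simp
          have "quot h x \<le> \<Gamma>"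
          proof (rule quot_le[OF h(1)])
            fix s assume s: "0 < s" "s < h"
            let ?x = "x + s *\<^sub>R e"
            have sb: "- (K + C) \<le> a ?x" "a ?x \<le> T" using shift_bounds[of s x] s h x x3 by auto
            have s3: "norm ?x + 3 \<le> \<rho>" using room[OF x(1), of 3] shift_norm[of s x] s h m0 m1 m pieces by simp
            have "norm (g ?x) \<le> \<Gamma>"
              unfolding \<Gamma>_def V_def by (rule bounds_above_level(2)[OF s3 sb(2) T0 sb(1)]) (use K cC in simp)
            then show "g ?x \<bullet> e \<le> \<Gamma>" using norm_cauchy_schwarz[of "g ?x" e] e by simp
          qed
          also have "\<Gamma> = (A - b) * m" using m by (simp add: A_def)
          also have "\<dots> \<le> (A - b) * v x"
          proof (rule mult_left_mono)
            show "m \<le> v x" by (rule low2[OF fr]) (use x room[OF x(1), of r2] m0 m1 m pieces cC in auto)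
            show "0 \<le> A - b" using \<Gamma> m by (simp add: A_def)
          qed
          finally show "quot h x \<le> (A - b) * v x" .
        next
          show "norm y \<le> N + (C * N + K + T) / c + 1" using ny N1 by simp
          show "\<bar>y \<bullet> f\<bar> \<le> N" using fe N1 by (simp add: y_def inner_commute)
          show "- K \<le> a y" using aK K by (simp add: y_def)
          show "a y \<le> T" using aT by (simp add: y_def)
        qed
        \<comment> \<open>The point \<open>y\<close> lies on the normal axis, where the tangential
          weight vanishes.\<close>
        also have "\<dots> = - b * v y + \<delta>" using fe by (simp add: y_def inner_commute)
        also have "\<dots> \<le> - b * m1 + b * m1 / 2"
        proof -
          have "m1 \<le> v y"
          proof (rule low1[OF fr])
            show "norm y + r1 \<le> \<rho>" using ny r\<rho> N1 m0 m1 m pieces unfolding r_def \<rho>'_def by linarith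
          qed (use aK aT in \<open>auto simp: y_def\<close>)
          then show ?thesis using b \<delta> by (intro add_mono) auto
        qed
        finally show ?thesis by simp
      qed
      have "\<forall>\<^sub>F h in at_right 0. 0 < h \<and> h < (1::real)"
        by (auto simp: eventually_at_right_field intro!: exI[of _ 1])
      then have "\<forall>\<^sub>F h in at_right 0. quot h y \<le> - (b * m1 / 2)" by eventually_elim (use cmp in auto)
      then show "g (t *\<^sub>R e) \<bullet> e \<le> - (b * m1 / 2)" unfolding y_def by (rule derivative_le_of_quot)
    qed
  qed
qed

section \<open>Scaling back\<close>

text \<open>Where \<open>a \<le> T\<close>, the strip bound with lower level
  \<open>- (C * D)\<close> gives a constant, which is stronger than required. Where
  \<open>a > T\<close>, the interior bound of order \<open>1 / sqrt a\<close> is used together with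
  \<open>a \<le> C * (1 + \<bar>t\<bar>)\<close>.\<close>

lemma front_derivative_bound:
  assumes c: "c > 0" and C: "C > 0" and D: "D > 0"
  shows "\<exists>k>0. \<exists>r. \<forall>v a g e \<rho> t. front v a g e \<rho> c C \<longrightarrow> a 0 = 0 \<longrightarrow> r \<le> \<rho> \<longrightarrow> - (\<rho> / 2) \<le> t \<longrightarrow> t \<le> D \<longrightarrow>
     g (t *\<^sub>R e) \<bullet> e \<le> - k / sqrt (1 + \<bar>t\<bar>)"
proof -
  define M where "M = 1 + 200 * C + c + 45056 * C\<^sup>2 / c"
  have Q: "45056 * C\<^sup>2 / c > 0" using c C by simp
  have M1: "M \<ge> 1" using c C Q unfolding M_def by linarith
  have big: "200 * C \<le> \<alpha> * sqrt \<alpha> \<and> c \<le> \<alpha> * sqrt \<alpha> \<and> 45056 * C\<^sup>2 / c < \<alpha> * sqrt \<alpha>" if "\<alpha> \<ge> M" for \<alpha>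
  proof -
    have "sqrt \<alpha> \<ge> 1" using that M1 by simp
    then have "\<alpha> * 1 \<le> \<alpha> * sqrt \<alpha>" using that M1 by (intro mult_left_mono) auto
    then show ?thesis using that c C Q unfolding M_def by linarith
  qed
  define T where "T = M + C"
  have KD: "C * D > 0" using C D by simp
  obtain k1 r1 where k1: "k1 > 0" and
    strip: "\<forall>v a g e \<rho> t. front v a g e \<rho> c C \<longrightarrow> a 0 = 0 \<longrightarrow> r1 \<le> \<rho> \<longrightarrow> \<bar>t\<bar> < \<rho> \<longrightarrow>
     - (C * D) \<le> a (t *\<^sub>R e) \<longrightarrow> a (t *\<^sub>R e) \<le> T \<longrightarrow> g (t *\<^sub>R e) \<bullet> e \<le> - k1"
    using strip_derivative_bound[OF c C KD _ T_def big] M1 by fastforce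
  define k where "k = min k1 (c / 16 / sqrt C)"
  have k: "k > 0" "k \<le> k1" "k \<le> c / 16 / sqrt C" using k1 c C by (auto simp: k_def)
  show ?thesis
  proof (rule exI[of _ k], intro conjI k(1), rule exI[of _ "max r1 (2 * D + 1)"], intro allI impI)
    fix v a g e \<rho> t
    assume fr: "front v a g e \<rho> c C" and a0: "a 0 = 0" and r: "max r1 (2 * D + 1) \<le> \<rho>"
      and t: "- (\<rho> / 2) \<le> t" "t \<le> D"
    interpret front v a g e \<rho> c C by fact
    have t\<rho>: "\<bar>t\<bar> < \<rho>" "\<bar>t\<bar> \<le> \<rho> / 2" and \<rho>: "\<rho> > 0" using t r D by auto
    have b: "t *\<^sub>R e \<in> ball 0 \<rho>" "(0::real^2) \<in> ball 0 \<rho>" using t\<rho> \<rho> e by auto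
    have abs: "\<bar>a (t *\<^sub>R e)\<bar> \<le> C * \<bar>t\<bar>" using lip[OF b] a0 e by simp
    have nonpos: "a (t *\<^sub>R e) \<le> 0" if "t \<ge> 0"
    proof -
      have "a (0 + t *\<^sub>R e) \<le> a 0 - c * t" using b that by (intro decr) auto
      moreover have "c * t \<ge> 0" using c that by simp
      ultimately show ?thesis using a0 by simp
    qed
    have nonneg: "a (t *\<^sub>R e) \<ge> 0" if "t < 0"
    proof -
      have "a (t *\<^sub>R e + (- t) *\<^sub>R e) \<le> a (t *\<^sub>R e) - c * (- t)" using b that by (intro decr) auto
      moreover have "c * (- t) \<ge> 0" using c that by (intro mult_nonneg_nonneg) auto
      ultimately show ?thesis using a0 by simp
    qed
    have sq1: "sqrt (1 + \<bar>t\<bar>) \<ge> 1" by simp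
    show "g (t *\<^sub>R e) \<bullet> e \<le> - k / sqrt (1 + \<bar>t\<bar>)"
    proof (cases "a (t *\<^sub>R e) \<le> T")
      case True
      have "- (C * D) \<le> a (t *\<^sub>R e)"
      proof (cases "t \<ge> 0")
        case True
        then have "C * \<bar>t\<bar> \<le> C * D" using t C by simp
        then show ?thesis using abs by (simp add: abs_le_iff)
      next
        case False then show ?thesis using nonneg KD by simp
      qed
      then have "g (t *\<^sub>R e) \<bullet> e \<le> - k1" using strip[rule_format, OF fr a0 _ t\<rho>(1)] r True by simp
      moreover have "k / sqrt (1 + \<bar>t\<bar>) \<le> k / 1" using sq1 k by (intro divide_left_mono) auto
      ultimately show ?thesis using k by simp
    next
      case False
      then have aM: "a (t *\<^sub>R e) \<ge> M" and apos: "a (t *\<^sub>R e) > 0" using C M1 by (auto simp: T_def)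
      have "t < 0" using nonpos apos by force
      \<comment> \<open>The interior bound needs a disc of radius \<open>a / (4 * C)\<close>, at
        most a quarter of \<open>\<bar>t\<bar>\<close>; it fits because \<open>t\<close> is at least
        \<open>- (\<rho> / 2)\<close>.\<close>
      have "a (t *\<^sub>R e) / (4 * C) \<le> \<bar>t\<bar> / 4" using abs C by (simp add: field_simps abs_le_iff)
      then have "norm (t *\<^sub>R e) + a (t *\<^sub>R e) / (4 * C) \<le> \<rho>" using t\<rho>(2) e \<rho> by simp
      then have "g (t *\<^sub>R e) \<bullet> e \<le> - (c / 16) / sqrt (a (t *\<^sub>R e))"
        using big[OF aM] apos by (intro interior_derivative_bound[OF refl]) auto
      also have "\<dots> \<le> - k / sqrt (1 + \<bar>t\<bar>)"
      proof -
        have "sqrt (a (t *\<^sub>R e)) \<le> sqrt (C * (1 + \<bar>t\<bar>))"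
          using abs C by (simp add: abs_le_iff algebra_simps)
        then have "c / 16 / (sqrt C * sqrt (1 + \<bar>t\<bar>)) \<le> c / 16 / sqrt (a (t *\<^sub>R e))"
          using c C apos by (intro divide_left_mono) (auto simp: real_sqrt_mult)
        moreover have "k / sqrt (1 + \<bar>t\<bar>) \<le> c / 16 / sqrt C / sqrt (1 + \<bar>t\<bar>)"
          using k by (intro divide_right_mono) auto
        ultimately show ?thesis by simp
      qed
      finally show ?thesis .
    qed
  qed
qed

text \<open>\<open>\<sigma>\<close> stands for the cube root of \<epsilon>, which keeps all
  exponents integral. Lengths scale by \<open>\<sigma>\<^sup>2\<close>, and the factor
  \<open>(\<sigma>\<^sup>2)\<^sup>2 / (\<sigma> ^ 3)\<^sup>2 = 1 / \<sigma>\<^sup>2\<close> is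
  absorbed by the scaling of \<open>u\<^sup>2\<close> and \<open>a\<close>. As \<open>a\<close> is
  divided by the length scale, its slopes are preserved.\<close>

lemma front_rescale:
  fixes u a :: "real^2 \<Rightarrow> real"
  assumes jet: "\<And>y. has_jet u y (G y) (u y * ((u y)\<^sup>2 - a y) / (\<sigma> ^ 3)\<^sup>2)" and pos: "\<And>y. u y > 0"
    and \<sigma>: "\<sigma> > 0" and e: "norm e = 1" and c: "c > 0" and C: "C > 0"
    and lip: "\<And>x y. x \<in> ball x0 r \<Longrightarrow> y \<in> ball x0 r \<Longrightarrow> \<bar>a x - a y\<bar> \<le> C * dist x y"
    and decr: "\<And>x h. x \<in> ball x0 r \<Longrightarrow> x + h *\<^sub>R e \<in> ball x0 r \<Longrightarrow> h \<ge> 0 \<Longrightarrow> a (x + h *\<^sub>R e) \<le> a x - c * h"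
  shows "front (\<lambda>s. 1 / \<sigma> * u (x0 + \<sigma>\<^sup>2 *\<^sub>R s)) (\<lambda>s. a (x0 + \<sigma>\<^sup>2 *\<^sub>R s) / \<sigma>\<^sup>2) (\<lambda>s. \<sigma> *\<^sub>R G (x0 + \<sigma>\<^sup>2 *\<^sub>R s)) e (r / \<sigma>\<^sup>2) c C"
proof unfold_locales
  have s2: "\<sigma>\<^sup>2 > 0" using \<sigma> by simp
  have inb: "x0 + \<sigma>\<^sup>2 *\<^sub>R x \<in> ball x0 r" if "x \<in> ball 0 (r / \<sigma>\<^sup>2)" for x
    using that s2 by (simp add: dist_norm field_simps)
  fix x y :: "real^2" and h :: real
  show "0 < 1 / \<sigma> * u (x0 + \<sigma>\<^sup>2 *\<^sub>R x)" using pos \<sigma> by simp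
  define Y where "Y = x0 + \<sigma>\<^sup>2 *\<^sub>R x"
  have "has_jet (\<lambda>s. 1 / \<sigma> * u (x0 + \<sigma>\<^sup>2 *\<^sub>R s)) x ((1 / \<sigma>) *\<^sub>R (\<sigma>\<^sup>2 *\<^sub>R G Y)) (1 / \<sigma> * ((\<sigma>\<^sup>2)\<^sup>2 * (u Y * ((u Y)\<^sup>2 - a Y) / (\<sigma> ^ 3)\<^sup>2)))"
    unfolding Y_def by (intro has_jet_cmult has_jet_scale jet)
  moreover have "(1 / \<sigma>) *\<^sub>R (\<sigma>\<^sup>2 *\<^sub>R G Y) = \<sigma> *\<^sub>R G Y" using \<sigma> by (simp add: power2_eq_square)
  moreover have "1 / \<sigma> * ((\<sigma>\<^sup>2)\<^sup>2 * (u Y * ((u Y)\<^sup>2 - a Y) / (\<sigma> ^ 3)\<^sup>2)) = 1 / \<sigma> * u Y * ((1 / \<sigma> * u Y)\<^sup>2 - a Y / \<sigma>\<^sup>2)"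
    using \<sigma> by (simp add: field_simps power2_eq_square power3_eq_cube)
  ultimately show "has_jet (\<lambda>s. 1 / \<sigma> * u (x0 + \<sigma>\<^sup>2 *\<^sub>R s)) x (\<sigma> *\<^sub>R G (x0 + \<sigma>\<^sup>2 *\<^sub>R x))
     (1 / \<sigma> * u (x0 + \<sigma>\<^sup>2 *\<^sub>R x) * ((1 / \<sigma> * u (x0 + \<sigma>\<^sup>2 *\<^sub>R x))\<^sup>2 - a (x0 + \<sigma>\<^sup>2 *\<^sub>R x) / \<sigma>\<^sup>2))"
    by (simp only: Y_def)
  show "norm e = 1" "c > 0" "C > 0" by fact+
  {
    assume "x \<in> ball 0 (r / \<sigma>\<^sup>2)" "y \<in> ball 0 (r / \<sigma>\<^sup>2)"
    from lip[OF inb[OF this(1)] inb[OF this(2)]]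
    have "\<bar>a (x0 + \<sigma>\<^sup>2 *\<^sub>R x) - a (x0 + \<sigma>\<^sup>2 *\<^sub>R y)\<bar> \<le> C * (\<sigma>\<^sup>2 * dist x y)"
      by (simp add: dist_norm flip: scaleR_diff_right)
    then show "\<bar>a (x0 + \<sigma>\<^sup>2 *\<^sub>R x) / \<sigma>\<^sup>2 - a (x0 + \<sigma>\<^sup>2 *\<^sub>R y) / \<sigma>\<^sup>2\<bar> \<le> C * dist x y"
      using s2 by (simp add: abs_divide field_simps flip: diff_divide_distrib)
  }
  {
    assume "x \<in> ball 0 (r / \<sigma>\<^sup>2)" and xh: "x + h *\<^sub>R e \<in> ball 0 (r / \<sigma>\<^sup>2)" and h: "0 \<le> h"
    have eq: "x0 + \<sigma>\<^sup>2 *\<^sub>R (x + h *\<^sub>R e) = (x0 + \<sigma>\<^sup>2 *\<^sub>R x) + (\<sigma>\<^sup>2 * h) *\<^sub>R e" by (simp add: algebra_simps)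
    have "a ((x0 + \<sigma>\<^sup>2 *\<^sub>R x) + (\<sigma>\<^sup>2 * h) *\<^sub>R e) \<le> a (x0 + \<sigma>\<^sup>2 *\<^sub>R x) - c * (\<sigma>\<^sup>2 * h)"
      by (rule decr) (use inb[OF \<open>x \<in> _\<close>] inb[OF xh] h in \<open>auto simp: eq\<close>)
    then show "a (x0 + \<sigma>\<^sup>2 *\<^sub>R (x + h *\<^sub>R e)) / \<sigma>\<^sup>2 \<le> a (x0 + \<sigma>\<^sup>2 *\<^sub>R x) / \<sigma>\<^sup>2 - c * h"
      unfolding eq using s2 by (simp add: field_simps)
  }
qed

section \<open>Regularity, level sets and local bounds on the potential\<close>

lemma C_1_gradient:
  fixes f :: "real^2 \<Rightarrow> real"
  assumes "C_k 1 f"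
  obtains G where "continuous_on UNIV G" "\<And>y. (f has_derivative (\<lambda>v. G y \<bullet> v)) (at y)"
proof
  let ?F = "\<lambda>y. frechet_derivative f (at y)"
  define G :: "real^2 \<Rightarrow> real^2" where "G = (\<lambda>y. \<chi> i. ?F y (axis i 1))"
  show "continuous_on UNIV G" unfolding G_def
    by (rule continuous_on_vec_lambda) (use assms in auto)
  fix y
  have d: "(f has_derivative ?F y) (at y)" using assms by (simp add: frechet_derivative_works)
  have "?F y v = G y \<bullet> v" for v
  proof -
    have "?F y v = ?F y (\<Sum>i\<in>UNIV. (v $ i) *\<^sub>R axis i 1)" using basis_expansion[of v] by (simp add: scalar_mult_eq_scaleR)
    also have "\<dots> = (\<Sum>i\<in>UNIV. (v $ i) * ?F y (axis i 1))"
      using has_derivative_linear[OF d] by (simp add: linear_sum linear_scale)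
    finally show ?thesis by (simp add: G_def inner_vec_def mult.commute)
  qed
  then have "?F y = (\<lambda>v. G y \<bullet> v)" by auto
  then show "(f has_derivative (\<lambda>v. G y \<bullet> v)) (at y)" using d by simp
qed

text \<open>The components of the gradient are the partial derivatives, which are differentiable
  again; the trace of the derivative of the gradient is the \<open>laplacian\<close>.\<close>

lemma C_2_jet:
  assumes "C_k 2 f"
  obtains G where "\<And>y. has_jet f y (G y) (laplacian f y)"
proof -
  have C1: "C_k 1 f" and C1': "\<And>i. C_k 1 (partial_deriv i f)"
    using assms by (auto simp: numeral_2_eq_2 partial_deriv_def[abs_def] intro: differentiable_imp_continuous_on
      simp: differentiable_on_def intro!: differentiable_at_withinI)
  obtain G where G: "\<And>y. (f has_derivative (\<lambda>v. G y \<bullet> v)) (at y)" using C_1_gradient[OF C1] by blast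
  have Gi: "G y $ i = partial_deriv i f y" for y i
    unfolding partial_deriv_def frechet_derivative_at[OF G, symmetric] by (simp add: inner_axis)
  have "has_jet f y (G y) (laplacian f y)" for y
  proof (rule has_jetI[OF G])
    let ?H = "\<lambda>v. \<chi> i. frechet_derivative (partial_deriv i f) (at y) v"
    have "((\<lambda>z. G z $ i) has_derivative (\<lambda>v. ?H v $ i)) (at y)" for i
      using C1'[of i] by (simp add: Gi frechet_derivative_works)
    then show "(G has_derivative ?H) (at y)"
      by (subst has_derivative_componentwise_within) (auto simp: Basis_vec_def inner_axis)
    show "laplacian f y = (\<Sum>i\<in>UNIV. ?H (axis i 1) $ i)"
      by (simp add: laplacian_def partial_deriv_def[of _ "partial_deriv _ f"])
  qed simp
  then show ?thesis using that by blast
qed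


text \<open>One inequality passes to the closure of \<open>S\<close> by continuity. For the other
  the sign is known only off the closure, so \<open>x\<close> is approached from outside along its
  normal.\<close>

lemma level_on_frontier:
  fixes W :: "real^2 \<Rightarrow> real"
  assumes W: "continuous_on UNIV W" and ins: "\<And>y. y \<in> S \<Longrightarrow> W y < l" and out: "\<And>y. y \<notin> closure S \<Longrightarrow> l < W y"
    and n: "outward_unit_normal S x n"
  shows "W x = l"
proof (rule antisym)
  have "closed {y. W y \<le> l}" using W by (intro closed_Collect_le continuous_on_const) 
  then have "closure S \<subseteq> {y. W y \<le> l}" using ins by (intro closure_minimal) (auto intro: less_imp_le)
  then show "W x \<le> l" using n by (auto simp: outward_unit_normal_def frontier_def)
  have "n \<bullet> n > 0" using n by (simp add: outward_unit_normal_def norm_eq_1)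
  then have "\<forall>\<^sub>F s in at_right 0. x + s *\<^sub>R n \<notin> closure S" using n by (auto simp: outward_unit_normal_def)
  then have ev: "\<forall>\<^sub>F s in at_right 0. l \<le> W (x + s *\<^sub>R n)" by eventually_elim (use out in \<open>auto intro: less_imp_le\<close>)
  have "isCont W (x + 0 *\<^sub>R n)" using W by (simp add: continuous_on_eq_continuous_at)
  then have "((\<lambda>s. W (x + s *\<^sub>R n)) \<longlongrightarrow> W (x + 0 *\<^sub>R n)) (at_right 0)"
    by (rule isCont_tendsto_compose) (intro tendsto_intros)
  then show "l \<le> W x" using tendsto_lowerbound[OF _ ev] by simp
qed

text \<open>Mean value theorem: by convexity the segment between the two points stays in the ball,
  where the gradient bounds hold.\<close>

lemma difference_bounds_on_ball:
  fixes W :: "real^2 \<Rightarrow> real"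
  assumes W: "\<And>y. (W has_derivative (\<lambda>v. G y \<bullet> v)) (at y)"
    and C: "\<And>y. y \<in> ball x0 r \<Longrightarrow> norm (G y) \<le> C" and c: "\<And>y. y \<in> ball x0 r \<Longrightarrow> c \<le> G y \<bullet> e"
  shows "\<And>x y. x \<in> ball x0 r \<Longrightarrow> y \<in> ball x0 r \<Longrightarrow> \<bar>W x - W y\<bar> \<le> C * dist x y"
    and "\<And>x h. x \<in> ball x0 r \<Longrightarrow> x + h *\<^sub>R e \<in> ball x0 r \<Longrightarrow> h \<ge> 0 \<Longrightarrow> W x + c * h \<le> W (x + h *\<^sub>R e)"
proof -
  fix x y assume xy: "x \<in> ball x0 r" "y \<in> ball x0 r"
  have "norm (W x - W y) \<le> C * norm (x - y)"
  proof (rule differentiable_bound[OF convex_ball])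
    fix z assume z: "z \<in> ball x0 r"
    show "(W has_derivative (\<lambda>v. G z \<bullet> v)) (at z within ball x0 r)" using W by (rule has_derivative_at_withinI)
    show "onorm (\<lambda>v. G z \<bullet> v) \<le> C"
    proof (rule onorm_le)
      fix v
      have "\<bar>G z \<bullet> v\<bar> \<le> norm (G z) * norm v" by (rule Cauchy_Schwarz_ineq2)
      also have "\<dots> \<le> C * norm v" using C[OF z] by (intro mult_right_mono) auto
      finally show "norm (G z \<bullet> v) \<le> C * norm v" by simp
    qed
  qed (use xy in auto)
  then show "\<bar>W x - W y\<bar> \<le> C * dist x y" by (simp add: dist_norm)
next
  fix x h assume xh: "x \<in> ball x0 r" "x + h *\<^sub>R e \<in> ball x0 r" "h \<ge> (0::real)"
  show "W x + c * h \<le> W (x + h *\<^sub>R e)"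
  proof (cases "h = 0")
    case False
    then have h: "h > 0" using xh by simp
    have d: "((\<lambda>s. W (x + s *\<^sub>R e)) has_real_derivative (G (x + s *\<^sub>R e) \<bullet> e)) (at s)" for s
    proof -
      have "((\<lambda>s. x + s *\<^sub>R e) has_derivative (\<lambda>t. t *\<^sub>R e)) (at s)" by (auto intro!: derivative_eq_intros)
      from has_derivative_compose[OF this W] show ?thesis by (simp add: has_field_derivative_def mult_commute_abs)
    qed
    have "\<exists>z>0. z < h \<and> W (x + h *\<^sub>R e) - W (x + 0 *\<^sub>R e) = (h - 0) * (G (x + z *\<^sub>R e) \<bullet> e)"
      using MVT2[of 0 h "\<lambda>s. W (x + s *\<^sub>R e)" "\<lambda>s. G (x + s *\<^sub>R e) \<bullet> e"] h d by auto
    then obtain z where z: "0 < z" "z < h" "W (x + h *\<^sub>R e) - W x = h * (G (x + z *\<^sub>R e) \<bullet> e)" by auto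
    have "x + z *\<^sub>R e = (1 - z / h) *\<^sub>R x + (z / h) *\<^sub>R (x + h *\<^sub>R e)" using h by (simp add: algebra_simps)
    moreover have "(1 - z / h) *\<^sub>R x + (z / h) *\<^sub>R (x + h *\<^sub>R e) \<in> ball x0 r"
      using z h by (intro convexD[OF convex_ball] xh) auto
    ultimately have "c \<le> G (x + z *\<^sub>R e) \<bullet> e" using c by metis
    then have "h * c \<le> h * (G (x + z *\<^sub>R e) \<bullet> e)" using h by (intro mult_left_mono) auto
    then show ?thesis using z(3) mult.commute[of c h] by linarith
  qed simp
qed

section \<open>Uniform constants and conclusion\<close>

text \<open>A radius \<open>r0\<close> common to all boundary points determines \<open>d'\<close>
  together with \<open>\<delta>\<^sub>0\<close>, before \<open>D\<close> is given. The constant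
  \<open>c\<close> is obtained after \<open>D\<close>, since the strip in which \<open>v\<close> is
  estimated reaches down to level \<open>- (C * D)\<close>.\<close>

theorem mainTheorem3:
  fixes W :: "real^2 \<Rightarrow> real"
    and lam :: "real \<Rightarrow> real"                 (* lam 0 is lambda_0, lam eps is lambda_eps *)
    and \<eta> :: "real \<Rightarrow> real^2 \<Rightarrow> real"
    and Dom :: "real \<Rightarrow> (real^2) set"
    and L :: "real \<Rightarrow> real"                   (* L eps is the length of the boundary curve *)
    and \<gamma> \<nu> :: "real \<Rightarrow> real \<Rightarrow> real^2"
    and \<epsilon>\<^sub>0 \<delta>\<^sub>0 :: real
  assumes eps0: "\<epsilon>\<^sub>0 > 0" and delta0: "\<delta>\<^sub>0 > 0"
    \<comment> \<open>the potential\<close>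
    and W_nonneg: "\<forall>y. W y \<ge> 0"
    and W_C1: "C_k 1 W"
    and W_growth: "\<exists>C>1. \<exists>p\<ge>2. \<forall>y. norm y \<ge> C \<longrightarrow>
          1 / C * norm y powr p \<le> W y \<and> W y \<le> C * norm y powr p"
    \<comment> \<open>the limiting domain\<close>
    and lam0_gt: "lam 0 > (INF y. W y)"
    and lam0_mass: "(LINT y|lebesgue. max (lam 0 - W y) 0) = 1"
    and Dom0: "Dom 0 = {y. W y < lam 0}"
    and Dom0_domain: "simply_connected_domain (Dom 0)" "bounded (Dom 0)" "0 \<in> Dom 0"
          "smooth_boundary (Dom 0)"
    and Dom0_normal: "\<forall>x n. outward_unit_normal (Dom 0) x n \<longrightarrow> frechet_derivative W (at x) n > 0"
    \<comment> \<open>the minimizer and its Lagrange multiplier\<close>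
    and eta_min: "\<forall>\<epsilon>\<in>{0<..<\<epsilon>\<^sub>0}. positive_GP_minimizer W \<epsilon> (\<eta> \<epsilon>)"
    and eta_unique: "\<forall>\<epsilon>\<in>{0<..<\<epsilon>\<^sub>0}. \<forall>w. positive_GP_minimizer W \<epsilon> w \<longrightarrow>
          (AE y in lebesgue. w y = \<eta> \<epsilon> y)"
    and eta_C2: "\<forall>\<epsilon>\<in>{0<..<\<epsilon>\<^sub>0}. C_k 2 (\<eta> \<epsilon>)"
    and eta_eq: "\<forall>\<epsilon>\<in>{0<..<\<epsilon>\<^sub>0}. \<forall>y.
          - laplacian (\<eta> \<epsilon>) y + 1 / \<epsilon>\<^sup>2 * \<eta> \<epsilon> y * (W y + (\<eta> \<epsilon> y)\<^sup>2) = 1 / \<epsilon>\<^sup>2 * lam \<epsilon> * \<eta> \<epsilon> y"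
    and eta_decay: "\<forall>\<epsilon>\<in>{0<..<\<epsilon>\<^sub>0}. (\<eta> \<epsilon> \<longlongrightarrow> 0) at_infinity"
    and lam_close: "\<exists>C>0. \<forall>\<epsilon>\<in>{0<..<\<epsilon>\<^sub>0}. \<bar>lam \<epsilon> - lam 0\<bar> \<le> C * \<bar>ln \<epsilon>\<bar> powr (1/2) * \<epsilon>"
    \<comment> \<open>the perturbed domains and the tubular coordinates\<close>
    and Dom_domain: "\<forall>\<epsilon>\<in>{0..<\<epsilon>\<^sub>0}. simply_connected_domain (Dom \<epsilon>)"
    and Dom_inside: "\<forall>\<epsilon>\<in>{0..<\<epsilon>\<^sub>0}. \<forall>y\<in>Dom \<epsilon>. lam \<epsilon> - W y > 0"
    and Dom_outside: "\<forall>\<epsilon>\<in>{0..<\<epsilon>\<^sub>0}. \<forall>y. y \<notin> closure (Dom \<epsilon>) \<longrightarrow> lam \<epsilon> - W y < 0"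
    and boundary: "\<forall>\<epsilon>\<in>{0..<\<epsilon>\<^sub>0}. arc_length_boundary (Dom \<epsilon>) (L \<epsilon>) (\<gamma> \<epsilon>) (\<nu> \<epsilon>)"
    and perturbation: "smooth_perturbation \<epsilon>\<^sub>0 (\<lambda>\<epsilon>. frontier (Dom \<epsilon>)) (L 0) (\<gamma> 0) (\<nu> 0)"
    and normal_deriv: "\<exists>c>0. \<forall>\<epsilon>\<in>{0..<\<epsilon>\<^sub>0}. \<forall>\<theta>.
          frechet_derivative (\<lambda>y. lam \<epsilon> - W y) (at (\<gamma> \<epsilon> \<theta>)) (\<nu> \<epsilon> \<theta>) \<le> - c"
    and tubular: "\<forall>\<epsilon>\<in>{0..<\<epsilon>\<^sub>0}. bij_betw (\<lambda>(t, \<theta>). tube (\<gamma> \<epsilon>) (\<nu> \<epsilon>) t \<theta>)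
          ({- \<delta>\<^sub>0<..<\<delta>\<^sub>0} \<times> {0..<L \<epsilon>}) {y. infdist y (frontier (Dom \<epsilon>)) < \<delta>\<^sub>0}"
  shows "\<exists>d'>0. d' < \<delta>\<^sub>0 \<and> (\<forall>D>0. \<exists>c>0. \<forall>\<^sub>F \<epsilon> in at_right 0.
           \<forall>t\<in>{- d'..D * \<epsilon> powr (2/3)}. \<forall>\<theta>\<in>{0..<L \<epsilon>}.
             deriv_t (\<gamma> \<epsilon>) (\<nu> \<epsilon>) (\<eta> \<epsilon>) t \<theta> \<le> - c * (\<bar>t\<bar> + \<epsilon> powr (2/3)) powr (-1/2))"
proof -
  obtain G where Gc: "continuous_on UNIV G" and G: "\<And>y. (W has_derivative (\<lambda>v. G y \<bullet> v)) (at y)"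
    using C_1_gradient[OF W_C1] by blast
  have Wc: "continuous_on UNIV W"
    using G by (auto intro!: continuous_at_imp_continuous_on has_derivative_continuous)
  obtain c1 where c1: "c1 > 0" and nd: "\<And>\<epsilon> \<theta>. \<epsilon> \<in> {0..<\<epsilon>\<^sub>0} \<Longrightarrow> c1 \<le> G (\<gamma> \<epsilon> \<theta>) \<bullet> \<nu> \<epsilon> \<theta>"
  proof -
    obtain c1 where c1: "c1 > 0" "\<forall>\<epsilon>\<in>{0..<\<epsilon>\<^sub>0}. \<forall>\<theta>. frechet_derivative (\<lambda>y. lam \<epsilon> - W y) (at (\<gamma> \<epsilon> \<theta>)) (\<nu> \<epsilon> \<theta>) \<le> - c1"
      using normal_deriv by blast
    have "frechet_derivative (\<lambda>y. lam \<epsilon> - W y) (at y) = (\<lambda>v. - (G y \<bullet> v))" for \<epsilon> y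
    proof -
      have "((\<lambda>y. lam \<epsilon> - W y) has_derivative (\<lambda>v. - (G y \<bullet> v))) (at y)"
        by (auto intro!: derivative_eq_intros G)
      from frechet_derivative_at[OF this] show ?thesis by simp
    qed
    with c1 that show ?thesis by (simp only: neg_le_iff_le)
  qed
  have nu: "outward_unit_normal (Dom \<epsilon>) (\<gamma> \<epsilon> \<theta>) (\<nu> \<epsilon> \<theta>)" if "\<epsilon> \<in> {0..<\<epsilon>\<^sub>0}" for \<epsilon> \<theta>
    using bspec[OF boundary that] unfolding arc_length_boundary_def by blast
  have level: "W (\<gamma> \<epsilon> \<theta>) = lam \<epsilon>" if "\<epsilon> \<in> {0..<\<epsilon>\<^sub>0}" for \<epsilon> \<theta>
    by (rule level_on_frontier[OF Wc _ _ nu[OF that]]) (use bspec[OF Dom_inside that] bspec[OF Dom_outside that] in fastforce)+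
  obtain Cl where Cl: "Cl > 0" "\<And>\<epsilon>. \<epsilon> \<in> {0<..<\<epsilon>\<^sub>0} \<Longrightarrow> \<bar>lam \<epsilon> - lam 0\<bar> \<le> Cl * \<bar>ln \<epsilon>\<bar> powr (1/2) * \<epsilon>"
    using lam_close by blast
  have "((\<lambda>\<epsilon>. \<bar>ln \<epsilon>\<bar> powr (1/2) * \<epsilon>) \<longlongrightarrow> 0) (at_right (0::real))" by real_asymp
  then have "((\<lambda>\<epsilon>. Cl * (\<bar>ln \<epsilon>\<bar> powr (1/2) * \<epsilon>)) \<longlongrightarrow> Cl * 0) (at_right (0::real))" by (intro tendsto_intros)
  then have lim: "\<forall>\<^sub>F \<epsilon> in at_right 0. Cl * (\<bar>ln \<epsilon>\<bar> powr (1/2) * \<epsilon>) < 1" by (rule order_tendstoD) simp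
  have small: "\<forall>\<^sub>F \<epsilon> in at_right 0. 0 < \<epsilon> \<and> \<epsilon> < \<epsilon>\<^sub>0"
    using eps0 by (auto simp: eventually_at_right_field intro!: exI[of _ \<epsilon>\<^sub>0])
  have lam1: "\<forall>\<^sub>F \<epsilon> in at_right 0. lam \<epsilon> \<le> lam 0 + 1"
    using lim small
  proof eventually_elim
    case (elim \<epsilon>)
    have "\<bar>lam \<epsilon> - lam 0\<bar> \<le> 1" using Cl(2)[of \<epsilon>] elim by (simp add: mult.assoc)
    then show ?case by linarith
  qed
  \<comment> \<open>Growth at infinity bounds the sublevel set at \<open>lam 0 + 1\<close>, which
    contains the boundary curves for all small \<epsilon>. Compactness of a ball one unit larger
    gives constants uniform in \<epsilon> and in the base point.\<close>
  obtain Rb where Rb: "\<And>y. W y \<le> lam 0 + 1 \<Longrightarrow> norm y \<le> Rb"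
  proof -
    obtain K p where K: "K > 1" "p \<ge> 2" "\<And>y. norm y \<ge> K \<Longrightarrow> 1 / K * norm y powr p \<le> W y"
      using W_growth by blast
    have "norm y \<le> K + K * \<bar>lam 0 + 1\<bar>" if "W y \<le> lam 0 + 1" for y
    proof (cases "norm y \<ge> K")
      case True
      then have "norm y powr 1 \<le> norm y powr p" using K by (intro powr_mono) auto
      then have "1 / K * norm y \<le> 1 / K * norm y powr p" using K True by (intro mult_left_mono) auto
      then have "1 / K * norm y \<le> lam 0 + 1" using K(3)[OF True] that by linarith
      then have "norm y \<le> K * (lam 0 + 1)" using K by (simp add: field_simps)
      also have "\<dots> \<le> K + K * \<bar>lam 0 + 1\<bar>" using K mult_left_mono[of "lam 0 + 1" "\<bar>lam 0 + 1\<bar>" K] by linarith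
      finally show ?thesis .
    next
      case False
      moreover have "0 \<le> K * \<bar>lam 0 + 1\<bar>" using K by simp
      ultimately show ?thesis by linarith
    qed
    then show ?thesis using that by blast
  qed
  let ?B = "cball (0::real^2) (Rb + 1)"
  have GB: "continuous_on ?B G" using Gc continuous_on_subset by blast
  have "bounded (G ` ?B)" by (intro compact_imp_bounded compact_continuous_image GB compact_cball)
  then obtain C where C: "C > 0" "\<And>y. y \<in> ?B \<Longrightarrow> norm (G y) \<le> C"
    unfolding bounded_pos by blast
  \<comment> \<open>Half of the normal derivative \<open>c1\<close> at a boundary point persists, in
    the same fixed direction, on a disc of radius \<open>r0\<close> about that point.\<close>
  have "uniformly_continuous_on ?B G" by (intro compact_uniformly_continuous GB compact_cball)
  then obtain d where d: "d > 0" "\<And>x y. x \<in> ?B \<Longrightarrow> y \<in> ?B \<Longrightarrow> dist y x < d \<Longrightarrow> dist (G y) (G x) < c1 / 2"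
    unfolding uniformly_continuous_on_def using c1 by (meson half_gt_zero)
  define r0 where "r0 = min d 1"
  have r0: "r0 > 0" "r0 \<le> d" "r0 \<le> 1" using d by (auto simp: r0_def)
  define c where "c = c1 / 2"
  have c: "c > 0" using c1 by (simp add: c_def)
  \<comment> \<open>\<open>d' \<le> r0 / 2\<close> turns after rescaling into the lower limit
    \<open>- (\<rho> / 2)\<close> for \<open>t\<close> in
    \<open>front_derivative_bound\<close>.\<close>
  define d' where "d' = min \<delta>\<^sub>0 r0 / 2"
  have d': "d' > 0" "d' < \<delta>\<^sub>0" "d' \<le> r0 / 2" using delta0 r0 by (auto simp: d'_def)
  show ?thesis
  proof (rule exI[of _ d'], intro conjI d' allI impI)
    fix D :: real assume D: "D > 0"
    obtain k r where k: "k > 0" and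
      bound: "\<forall>v a g e \<rho> t. front v a g e \<rho> c C \<longrightarrow> a 0 = 0 \<longrightarrow> r \<le> \<rho> \<longrightarrow> - (\<rho> / 2) \<le> t \<longrightarrow> t \<le> D \<longrightarrow>
        g (t *\<^sub>R e) \<bullet> e \<le> - k / sqrt (1 + \<bar>t\<bar>)"
      using front_derivative_bound[OF c C(1) D] by fastforce
    \<comment> \<open>In rescaled length the disc has radius \<open>r0 / \<sigma>\<^sup>2\<close>,
      which must reach the threshold \<open>r\<close>; this decides how small \<epsilon> has to
      be.\<close>
    have "((\<lambda>\<epsilon>. r * \<epsilon> powr (2/3)) \<longlongrightarrow> r * 0) (at_right (0::real))" by (intro tendsto_intros) real_asymp
    then have "\<forall>\<^sub>F \<epsilon> in at_right 0. r * \<epsilon> powr (2/3) < r0" by (rule order_tendstoD) (use r0 in simp)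
    then have "\<forall>\<^sub>F \<epsilon> in at_right 0. \<forall>t\<in>{- d'..D * \<epsilon> powr (2/3)}. \<forall>\<theta>\<in>{0..<L \<epsilon>}.
             deriv_t (\<gamma> \<epsilon>) (\<nu> \<epsilon>) (\<eta> \<epsilon>) t \<theta> \<le> - k * (\<bar>t\<bar> + \<epsilon> powr (2/3)) powr (-1/2)"
      using lam1 small
    proof eventually_elim
      case (elim \<epsilon>)
      then have \<epsilon>: "\<epsilon> > 0" "\<epsilon> \<in> {0<..<\<epsilon>\<^sub>0}" "\<epsilon> \<in> {0..<\<epsilon>\<^sub>0}" by auto
      define \<sigma> where "\<sigma> = \<epsilon> powr (1/3)"
      have \<sigma>: "\<sigma> > 0" using \<epsilon> by (simp add: \<sigma>_def)
      have \<sigma>2: "\<sigma>\<^sup>2 = \<epsilon> powr (2/3)" and \<sigma>3: "\<sigma> ^ 3 = \<epsilon>"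
        using \<epsilon> by (simp_all add: \<sigma>_def powr_powr flip: powr_realpow)
      have s2: "\<sigma>\<^sup>2 > 0" using \<sigma> by simp
      show ?case
      proof (intro ballI)
        fix t \<theta> assume t: "t \<in> {- d'..D * \<epsilon> powr (2/3)}" and \<theta>: "\<theta> \<in> {0..<L \<epsilon>}"
        define x0 e where "x0 = \<gamma> \<epsilon> \<theta>" and "e = \<nu> \<epsilon> \<theta>"
        have e1: "norm e = 1" using nu[OF \<epsilon>(3)] by (simp add: e_def outward_unit_normal_def)
        have Wx0: "W x0 = lam \<epsilon>" unfolding x0_def by (rule level[OF \<epsilon>(3)])
        then have x0B: "norm x0 \<le> Rb" using Rb elim by simp
        have inB: "y \<in> ?B" if "y \<in> ball x0 r0" for y
          using that x0B r0 norm_triangle_sub[of y x0] by (simp add: dist_norm norm_minus_commute)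
        have GC: "norm (G y) \<le> C" if "y \<in> ball x0 r0" for y using C(2) inB[OF that] by blast
        have Gce: "c \<le> G y \<bullet> e" if y: "y \<in> ball x0 r0" for y
        proof -
          have "x0 \<in> ?B" using x0B by simp
          from d(2)[OF this inB[OF y]] have "norm (G x0 - G y) < c"
            using y r0 by (simp add: c_def dist_commute dist_norm norm_minus_commute)
          then have "(G x0 - G y) \<bullet> e < c" using norm_cauchy_schwarz[of "G x0 - G y" e] e1 by simp
          moreover have "c1 \<le> G x0 \<bullet> e" unfolding x0_def e_def by (rule nd[OF \<epsilon>(3)])
          ultimately show ?thesis by (simp add: c_def inner_diff_left)
        qed
        obtain H where H: "\<And>y. has_jet (\<eta> \<epsilon>) y (H y) (laplacian (\<eta> \<epsilon>) y)"
          using C_2_jet eta_C2 \<epsilon>(2) by blast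
        have jet: "has_jet (\<eta> \<epsilon>) y (H y) (\<eta> \<epsilon> y * ((\<eta> \<epsilon> y)\<^sup>2 - (lam \<epsilon> - W y)) / (\<sigma> ^ 3)\<^sup>2)" for y
        proof -
          have "laplacian (\<eta> \<epsilon>) y = 1 / \<epsilon>\<^sup>2 * \<eta> \<epsilon> y * (W y + (\<eta> \<epsilon> y)\<^sup>2) - 1 / \<epsilon>\<^sup>2 * lam \<epsilon> * \<eta> \<epsilon> y"
            using eta_eq \<epsilon>(2) by (auto simp: algebra_simps)
          also have "\<dots> = \<eta> \<epsilon> y * ((\<eta> \<epsilon> y)\<^sup>2 - (lam \<epsilon> - W y)) / (\<sigma> ^ 3)\<^sup>2"
            unfolding \<sigma>3 using \<epsilon>(1) by (simp add: field_simps)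
          finally show ?thesis using H[of y] by simp
        qed
        have lipW: "\<bar>W x - W y\<bar> \<le> C * dist x y" if "x \<in> ball x0 r0" "y \<in> ball x0 r0" for x y
          by (rule difference_bounds_on_ball(1)[where G=G and c=c and e=e, OF G _ _ that]) (use GC Gce in auto)
        have incrW: "W x + c * h \<le> W (x + h *\<^sub>R e)"
          if "x \<in> ball x0 r0" "x + h *\<^sub>R e \<in> ball x0 r0" "h \<ge> 0" for x h
          by (rule difference_bounds_on_ball(2)[where G=G and C=C, OF G _ _ that]) (use GC Gce in auto)
        let ?v = "\<lambda>s. 1 / \<sigma> * \<eta> \<epsilon> (x0 + \<sigma>\<^sup>2 *\<^sub>R s)" and ?a = "\<lambda>s. (lam \<epsilon> - W (x0 + \<sigma>\<^sup>2 *\<^sub>R s)) / \<sigma>\<^sup>2"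
          and ?g = "\<lambda>s. \<sigma> *\<^sub>R H (x0 + \<sigma>\<^sup>2 *\<^sub>R s)"
        have fr: "front ?v ?a ?g e (r0 / \<sigma>\<^sup>2) c C"
        proof (rule front_rescale[OF jet _ \<sigma> e1 c C(1)])
          show "0 < \<eta> \<epsilon> y" for y using eta_min \<epsilon>(2) by (auto simp: positive_GP_minimizer_def)
          show "\<bar>(lam \<epsilon> - W x) - (lam \<epsilon> - W y)\<bar> \<le> C * dist x y" if "x \<in> ball x0 r0" "y \<in> ball x0 r0" for x y
            using lipW[OF that] by (simp add: abs_minus_commute)
          show "lam \<epsilon> - W (x + h *\<^sub>R e) \<le> lam \<epsilon> - W x - c * h"
            if "x \<in> ball x0 r0" "x + h *\<^sub>R e \<in> ball x0 r0" "h \<ge> 0" for x h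
            using incrW[OF that] by simp
        qed
        define \<tau> where "\<tau> = t / \<sigma>\<^sup>2"
        have t\<tau>: "t = \<sigma>\<^sup>2 * \<tau>" using s2 by (simp add: \<tau>_def)
        have "?g (\<tau> *\<^sub>R e) \<bullet> e \<le> - k / sqrt (1 + \<bar>\<tau>\<bar>)"
        proof (rule bound[rule_format, OF fr])
          show "(lam \<epsilon> - W (x0 + \<sigma>\<^sup>2 *\<^sub>R 0)) / \<sigma>\<^sup>2 = 0" using Wx0 by simp
          show "r \<le> r0 / \<sigma>\<^sup>2" using elim(1) s2 by (simp add: \<sigma>2 field_simps)
          have "- (r0 / 2) \<le> t" using t d' by simp
          then show "- (r0 / \<sigma>\<^sup>2 / 2) \<le> \<tau>" using s2 by (simp add: \<tau>_def field_simps)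
          show "\<tau> \<le> D" using t s2 by (simp add: \<tau>_def \<sigma>2 field_simps)
        qed
        then have "\<sigma> * (H (x0 + t *\<^sub>R e) \<bullet> e) \<le> - k / sqrt (1 + \<bar>\<tau>\<bar>)" by (simp add: t\<tau>)
        then have "H (x0 + t *\<^sub>R e) \<bullet> e \<le> - k / (\<sigma> * sqrt (1 + \<bar>\<tau>\<bar>))" using \<sigma> by (simp add: field_simps)
        \<comment> \<open>Undoing the scaling of the weight: \<open>\<sigma>\<^sup>2\<close> times
          \<open>1 + \<bar>\<tau>\<bar>\<close> is
          \<open>\<bar>t\<bar> + \<sigma>\<^sup>2\<close>.\<close>
        also have "\<sigma> * sqrt (1 + \<bar>\<tau>\<bar>) = sqrt (\<bar>t\<bar> + \<sigma>\<^sup>2)"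
        proof -
          have "\<sigma> * sqrt (1 + \<bar>\<tau>\<bar>) = sqrt (\<sigma>\<^sup>2) * sqrt (1 + \<bar>\<tau>\<bar>)" using \<sigma> by simp
          also have "\<dots> = sqrt (\<sigma>\<^sup>2 * (1 + \<bar>\<tau>\<bar>))" by (simp only: real_sqrt_mult)
          also have "\<sigma>\<^sup>2 * (1 + \<bar>\<tau>\<bar>) = \<bar>t\<bar> + \<sigma>\<^sup>2" using s2 by (simp add: t\<tau> abs_mult algebra_simps)
          finally show ?thesis .
        qed
        also have "- k / sqrt (\<bar>t\<bar> + \<sigma>\<^sup>2) = - k * (\<bar>t\<bar> + \<epsilon> powr (2/3)) powr (-1/2)"
          using s2 by (simp add: \<sigma>2[symmetric] powr_minus_divide powr_half_sqrt add_nonneg_pos)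
        finally have "H (x0 + t *\<^sub>R e) \<bullet> e \<le> - k * (\<bar>t\<bar> + \<epsilon> powr (2/3)) powr (-1/2)" .
        moreover have "deriv_t (\<gamma> \<epsilon>) (\<nu> \<epsilon>) (\<eta> \<epsilon>) t \<theta> = H (x0 + t *\<^sub>R e) \<bullet> e"
        proof -
          have "((\<lambda>s. x0 + s *\<^sub>R e) has_derivative (\<lambda>t. t *\<^sub>R e)) (at t)" by (auto intro!: derivative_eq_intros)
          from has_derivative_compose[OF this has_jet_derivative[OF H]]
          have "((\<lambda>s. \<eta> \<epsilon> (x0 + s *\<^sub>R e)) has_real_derivative (H (x0 + t *\<^sub>R e) \<bullet> e)) (at t)"
            by (simp add: has_field_derivative_def mult_commute_abs)
          then show ?thesis unfolding deriv_t_def tube_def x0_def e_def by (rule DERIV_imp_deriv)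
        qed
        ultimately show "deriv_t (\<gamma> \<epsilon>) (\<nu> \<epsilon>) (\<eta> \<epsilon>) t \<theta> \<le> - k * (\<bar>t\<bar> + \<epsilon> powr (2/3)) powr (-1/2)" by simp
      qed
    qed
    with k show "\<exists>c>0. \<forall>\<^sub>F \<epsilon> in at_right 0. \<forall>t\<in>{- d'..D * \<epsilon> powr (2/3)}. \<forall>\<theta>\<in>{0..<L \<epsilon>}.
             deriv_t (\<gamma> \<epsilon>) (\<nu> \<epsilon>) (\<eta> \<epsilon>) t \<theta> \<le> - c * (\<bar>t\<bar> + \<epsilon> powr (2/3)) powr (-1/2)" by blast
  qed
qed

end
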